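(* For every integer $n\ge 0$, the following identity of polynomials in $x$ holds: $$\sum_{g\ge 0}A(n,g)\,x^{n+1-2g}=\frac{(2n)!}{2^n\,n!}\sum_{k\ge 0}\binom{n}{k}\binom{x+n-k}{n+1}.$$
   Context: $A(n,g)$ is the number of rooted one-face maps of genus $g$ with $n$ edges, up to equivalence. A rooted one-face map with $n$ edges is encoded as a triple $(\alpha,\beta,\gamma)$ of permutations of $\{1,\dots,2n\}$ where $\alpha$ is an involution without fixed points (its cycles are the edges), $\gamma=(1,2,\dots,2n)$ is the long cycle (the boundary), and $\gamma=\alpha\beta$ (the cycles of $\beta$ are the vertices; products are composed right to left). The root has label $1$. Two triples $(\alpha,\beta,\gamma)$, $(\alpha',\beta',\gamma')$ are equivalent if there is a permutation $\pi$ with $\alpha'=\pi\alpha\pi^{-1}$, $\gamma'=\pi\gamma\pi^{-1}$, $\pi(1)=1$ (since $\gamma=\gamma'=(1,2,\dots,2n)$, this forces $\pi$ to be the identity). The genus $g$ is determined by $v-n+1=2-2g$, where $v$ is the number of cycles of $\beta$. Thus $A(n,g)$ is the number of fixed-point-free involutions $\alpha$ of $\{1,\dots,2n\}$ such that $\alpha^{-1}\gamma$ has exactly $n+1-2g$ cycles; in particular $A(n,g)=0$ if $2g>n$. For $n=0$ the only map is the single vertex: $A(0,0)=1$ and $A(0,g)=0$ for $g>0$. For a polynomial $y$ and integer $m\ge0$, $\binom{y}{m}=y(y-1)\cdots(y-m+1)/m!$. *)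

theory Defs
  imports
    "HOL-Computational_Algebra.Polynomial"
    "HOL-Combinatorics.Cycles"
    "HOL-Combinatorics.Orbits"
    "HOL-Library.Groups_Big_Fun"
begin

type_synonym perm_triple = "(nat \<Rightarrow> nat) \<times> (nat \<Rightarrow> nat) \<times> (nat \<Rightarrow> nat)"

text \<open>Permutations of \<open>{1..2n}\<close> are functions that are the identity outside this set.
  The long cycle \<open>(1,2,\<dots>,2n)\<close> is the identity for \<open>n = 0\<close>.\<close>

definition long_cycle :: "nat \<Rightarrow> nat \<Rightarrow> nat" where
  "long_cycle n = cycle_of_list [1..<2 * n + 1]"

definition one_face_maps :: "nat \<Rightarrow> perm_triple set" where
  "one_face_maps n = {(\<alpha>, \<beta>, \<gamma>).
     \<alpha> permutes {1..2 * n} \<and> (\<forall>i\<in>{1..2 * n}. \<alpha> (\<alpha> i) = i \<and> \<alpha> i \<noteq> i) \<and>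
     \<beta> permutes {1..2 * n} \<and> \<gamma> = long_cycle n \<and> \<gamma> = \<alpha> \<circ> \<beta>}"

text \<open>The number of vertices is the number of cycles of \<open>\<beta>\<close>, fixed points in \<open>{1..2n}\<close> included.
  The map without edges has no labels, but it has one vertex.\<close>

definition num_vertices :: "nat \<Rightarrow> (nat \<Rightarrow> nat) \<Rightarrow> nat" where
  "num_vertices n \<beta> = (if n = 0 then 1 else card (orbit \<beta> ` {1..2 * n}))"

definition one_face_maps_of_genus :: "nat \<Rightarrow> nat \<Rightarrow> perm_triple set" where
  "one_face_maps_of_genus n g = {(\<alpha>, \<beta>, \<gamma>) \<in> one_face_maps n.
     int (num_vertices n \<beta>) - int n + 1 = 2 - 2 * int g}"

definition rooted_equiv :: "nat \<Rightarrow> (perm_triple \<times> perm_triple) set" where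
  "rooted_equiv n = {((\<alpha>, \<beta>, \<gamma>), (\<alpha>', \<beta>', \<gamma>')).
     (\<alpha>, \<beta>, \<gamma>) \<in> one_face_maps n \<and> (\<alpha>', \<beta>', \<gamma>') \<in> one_face_maps n \<and>
     (\<exists>\<pi>. \<pi> permutes {1..2 * n} \<and> \<pi> 1 = 1 \<and>
        \<alpha>' = \<pi> \<circ> \<alpha> \<circ> inv \<pi> \<and> \<gamma>' = \<pi> \<circ> \<gamma> \<circ> inv \<pi>)}"

definition A :: "nat \<Rightarrow> nat \<Rightarrow> nat" where
  "A n g = card (one_face_maps_of_genus n g // rooted_equiv n)"

definition poly_binomial :: "'a::field_char_0 poly \<Rightarrow> nat \<Rightarrow> 'a poly" where
  "poly_binomial y m = smult (1 / fact m) (\<Prod>i<m. y - of_nat i)"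

end

theory Submission
  imports Defs "HOL-Computational_Algebra.Formal_Power_Series"
begin

text \<open>
  For a permutation \<open>f\<close> of a set \<open>S\<close> with \<open>m\<close> elements let \<open>T\<^sub>N(f)\<close> be the sum of
  \<open>N\<close> to the number of cycles of \<open>c\<^sup>-\<^sup>1 f\<close> over all \<open>m\<close>-cycles \<open>c\<close>. Zagier's theorem evaluates its
  generating function: \<open>\<Sum>\<^sub>N\<^sub>\<ge>\<^sub>1 T\<^sub>N(f) X\<^sup>N\<^sup>-\<^sup>1\<close> is \<open>(m-1)!\<close> times the product of \<open>1 - X\<^sup>l\<close> over the
  cycle lengths \<open>l\<close> of \<open>f\<close>, divided by \<open>(1 - X)\<^sup>m\<^sup>+\<^sup>2\<close>. It follows by induction on \<open>m\<close>,
  without characters: an \<open>m\<close>-cycle is uniquely \<open>(i p) c\<close> with \<open>c\<close> a full cycle on \<open>S - {p}\<close>, and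
  deleting \<open>p\<close> from \<open>f\<close> leaves a permutation \<open>r\<close> of \<open>S - {p}\<close> such that \<open>T\<^sub>N(f)\<close> is a combination
  of \<open>T\<^sub>N(r)\<close> and the \<open>T\<^sub>N((i a) r)\<close>, where \<open>a = f p\<close> and the transposition \<open>(i a)\<close> splits or
  merges cycles of \<open>r\<close>.

  All full cycles are conjugate and the set of matchings is invariant under conjugation. So
  averaging over the full cycles instead of fixing \<open>(1,\<dots>,2n)\<close> expresses the sum over one-face maps
  by Zagier's formula for matchings, where the product is \<open>(1 - X\<^sup>2)\<^sup>n\<close>. The coefficients of
  \<open>(1 + X)\<^sup>n / (1 - X)\<^sup>n\<^sup>+\<^sup>2\<close> give the right-hand side. That every map has an integral nonnegative genus
  is read off from the degree and the parity of this polynomial.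
\<close>

section \<open>Orbits and transpositions\<close>

lemma orbit_eq_orbit:
  assumes "permutation f" "y \<in> orbit f x"
  shows "orbit f y = orbit f x"
  using orbit_cyclic_eq3[OF cyclic_on_orbit'[OF assms(1)] assms(2)] .

text \<open>A walk along \<open>f\<close> that closes up repeats from there on, so its points are
  all iterates of its start. The orbits of \<open>transpose b a \<circ> f\<close> through
  \<open>a\<close> and \<open>b\<close> are found below by writing down such walks.\<close>

lemma orbit_closed_walk:
  assumes "0 < n" "h n = h 0" "\<And>t. t < n \<Longrightarrow> f (h t) = h (Suc t)"
  shows "orbit f (h 0) = h ` {..<n}"
proof -
  have iter: "(f ^^ t) (h 0) = h t" if "t \<le> n" for t
    using that by (induction t) (auto simp: assms(3))
  have "orbit f (h 0) = {(f ^^ t) (h 0) | t. t < n}"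
    by (rule orbit_altdef_bounded) (use assms(1,2) iter[of n] in auto)
  also have "\<dots> = (\<lambda>t. (f ^^ t) (h 0)) ` {..<n}" by auto
  also have "\<dots> = h ` {..<n}" by (intro image_cong) (auto simp: iter)
  finally show ?thesis .
qed

lemma orbit_transpose_comp_other:
  assumes "permutation f" "a \<notin> orbit f x" "b \<notin> orbit f x"
  shows "orbit (transpose a b \<circ> f) x = orbit f x"
proof (rule orbit_cong)
  show "x \<in> orbit f x" by (rule permutation_self_in_orbit[OF assms(1)])
next
  fix s assume "s \<in> orbit f x"
  then have "f s \<in> orbit f x" by (rule orbit.step)
  then show "(transpose a b \<circ> f) s = f s"
    using assms(2,3) by (auto simp: transpose_def)
qed

lemma orbit_enum:
  assumes "permutation f"
  shows "orbit f a = (\<lambda>t. (f ^^ t) a) ` {..<card (orbit f a)}"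
    and "inj_on (\<lambda>t. (f ^^ t) a) {..<card (orbit f a)}"
    and "(f ^^ card (orbit f a)) a = a"
    and "0 < card (orbit f a)"
proof -
  define n where "n = funpow_dist1 f a a"
  have a: "a \<in> orbit f a" by (rule permutation_self_in_orbit[OF assms])
  have orb: "orbit f a = (\<lambda>t. (f ^^ t) a) ` {0..<n}"
    using orbit_conv_funpow_dist1[OF a] by (simp add: n_def)
  have inj: "inj_on (\<lambda>t. (f ^^ t) a) {0..<n}"
    using inj_on_funpow_dist1[OF a] by (simp add: n_def)
  have n: "card (orbit f a) = n"
    by (subst orb) (simp add: card_image[OF inj])
  show "orbit f a = (\<lambda>t. (f ^^ t) a) ` {..<card (orbit f a)}"
    using orb n by (simp add: lessThan_atLeast0)
  show "inj_on (\<lambda>t. (f ^^ t) a) {..<card (orbit f a)}"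
    using inj n by (simp add: lessThan_atLeast0)
  show "(f ^^ card (orbit f a)) a = a"
    using funpow_dist1_prop[OF a] n by (simp add: n_def)
  show "0 < card (orbit f a)" using n by (simp add: n_def)
qed

text \<open>The transposition redirects only two steps of \<open>f\<close>: the one arriving at
  \<open>b\<close> now goes to \<open>a\<close>, and the one returning to \<open>a\<close> now goes
  to \<open>b\<close>. The cycle is cut just before \<open>b\<close> into two arcs, each closed
  up.\<close>

lemma orbit_transpose_comp_split:
  assumes f: "permutation f" and j: "0 < j" "j < card (orbit f a)"
  defines "b \<equiv> (f ^^ j) a"
  shows "orbit (transpose b a \<circ> f) a = (\<lambda>t. (f ^^ t) a) ` {..<j}"
    and "orbit (transpose b a \<circ> f) b = (\<lambda>t. (f ^^ t) a) ` {j..<card (orbit f a)}"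
proof -
  define k where "k = card (orbit f a)"
  have neq: "(f ^^ s) a \<noteq> (f ^^ t) a" if "s < k" "t < k" "s \<noteq> t" for s t
    using orbit_enum(2)[OF f, of a] that by (auto simp: k_def inj_on_def)
  have k: "(f ^^ k) a = a" by (simp add: k_def orbit_enum(3)[OF f])
  have jk: "j < k" using j by (simp add: k_def)
  show "orbit (transpose b a \<circ> f) a = (\<lambda>t. (f ^^ t) a) ` {..<j}"
  proof -
    define h where "h t = (if t < j then (f ^^ t) a else a)" for t
    have "orbit (transpose b a \<circ> f) (h 0) = h ` {..<j}"
    proof (rule orbit_closed_walk)
      fix t assume t: "t < j"
      show "(transpose b a \<circ> f) (h t) = h (Suc t)"
      proof (cases "Suc t < j")
        case True
        then have "(f ^^ Suc t) a \<noteq> b" "(f ^^ Suc t) a \<noteq> (f ^^ 0) a"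
          using neq[of "Suc t" j] neq[of "Suc t" 0] jk by (auto simp: b_def simp del: funpow.simps)
        then show ?thesis using True by (simp add: h_def)
      next
        case False
        then have "j = Suc t" using t by simp
        then show ?thesis by (simp add: h_def b_def)
      qed
    qed (use j in \<open>auto simp: h_def\<close>)
    moreover have "h ` {..<j} = (\<lambda>t. (f ^^ t) a) ` {..<j}"
      by (intro image_cong) (auto simp: h_def)
    ultimately show ?thesis using j by (simp add: h_def)
  qed
  show "orbit (transpose b a \<circ> f) b = (\<lambda>t. (f ^^ t) a) ` {j..<card (orbit f a)}"
  proof -
    define h where "h t = (if j + t < k then (f ^^ (j + t)) a else b)" for t
    have "orbit (transpose b a \<circ> f) (h 0) = h ` {..<k - j}"
    proof (rule orbit_closed_walk)
      fix t assume t: "t < k - j"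
      show "(transpose b a \<circ> f) (h t) = h (Suc t)"
      proof (cases "j + Suc t < k")
        case True
        then have "(f ^^ (j + Suc t)) a \<noteq> (f ^^ j) a" "(f ^^ (j + Suc t)) a \<noteq> (f ^^ 0) a"
          using neq[of "j + Suc t" j] neq[of "j + Suc t" 0] by (auto simp del: funpow.simps)
        then show ?thesis using True by (simp add: h_def b_def)
      next
        case False
        then have "k = Suc (j + t)" using t by simp
        then show ?thesis using k by (simp add: h_def)
      qed
    qed (use jk in \<open>auto simp: h_def b_def\<close>)
    moreover have "h ` {..<k - j} = (\<lambda>t. (f ^^ t) a) ` ((+) j ` {..<k - j})"
      by (simp add: image_image) (intro image_cong, auto simp: h_def)
    moreover have "(+) j ` {..<k - j} = {j..<k}"
      using jk by (simp add: lessThan_atLeast0)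
    ultimately show ?thesis using jk by (simp add: h_def b_def k_def)
  qed
qed

text \<open>The step of \<open>f\<close> that closes the cycle of \<open>a\<close> now leads to
  \<open>b\<close>, and the step that closes the cycle of \<open>b\<close> leads to
  \<open>a\<close>, so one walk runs through both cycles in turn.\<close>

lemma orbit_transpose_comp_merge:
  assumes f: "permutation f" and b: "b \<notin> orbit f a"
  shows "orbit (transpose b a \<circ> f) a = orbit f a \<union> orbit f b"
proof -
  define k l where "k = card (orbit f a)" and "l = card (orbit f b)"
  have k: "(f ^^ k) a = a" "0 < k" and l: "(f ^^ l) b = b" "0 < l"
    using orbit_enum(3,4)[OF f] by (auto simp: k_def l_def)
  have inj_a: "(f ^^ s) a \<noteq> a" if "0 < s" "s < k" for s
    using inj_onD[OF orbit_enum(2)[OF f, of a], of s 0] that by (auto simp: k_def)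
  have inj_b: "(f ^^ s) b \<noteq> b" if "0 < s" "s < l" for s
    using inj_onD[OF orbit_enum(2)[OF f, of b], of s 0] that by (auto simp: l_def)
  have self: "x \<in> orbit f x" for x by (rule permutation_self_in_orbit[OF f])
  have a: "a \<notin> orbit f b" using b self orbit_swap by metis
  have ab: "(f ^^ s) a \<noteq> b" "(f ^^ s) b \<noteq> a" for s
    using funpow_in_orbit[OF self[of a], of s] funpow_in_orbit[OF self[of b], of s] a b by auto
  define h where "h t = (if t < k then (f ^^ t) a else if t < k + l then (f ^^ (t - k)) b else a)" for t
  have "orbit (transpose b a \<circ> f) (h 0) = h ` {..<k + l}"
  proof (rule orbit_closed_walk)
    fix t assume t: "t < k + l"
    consider "Suc t < k" | "Suc t = k" | "k \<le> t" "Suc t < k + l" | "k \<le> t" "Suc t = k + l"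
      using t by linarith
    then show "(transpose b a \<circ> f) (h t) = h (Suc t)"
    proof cases
      case 1
      then show ?thesis using ab(1)[of "Suc t"] inj_a[of "Suc t"] by (simp add: h_def)
    next
      case 2
      then show ?thesis using k l by (auto simp: h_def)
    next
      case 3
      then show ?thesis using ab(2)[of "Suc (t - k)"] inj_b[of "Suc (t - k)"]
        by (simp add: h_def Suc_diff_le)
    next
      case 4
      then have "Suc (t - k) = l" by simp
      then show ?thesis using l 4 t by (auto simp: h_def)
    qed
  qed (use k l in \<open>auto simp: h_def\<close>)
  moreover have "{..<k + l} = {..<k} \<union> (+) k ` {..<l}"
    by (simp add: lessThan_atLeast0 ivl_disj_un add.commute)
  moreover have "h ` {..<k} = orbit f a"
    by (subst orbit_enum(1)[OF f]) (auto simp: k_def[symmetric] h_def intro!: image_cong)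
  moreover have "h ` (+) k ` {..<l} = orbit f b"
  proof -
    have "h ` (+) k ` {..<l} = (\<lambda>t. (f ^^ t) b) ` {..<l}"
      unfolding image_image by (intro image_cong) (auto simp: h_def)
    then show ?thesis using orbit_enum(1)[OF f, of b] by (simp add: l_def)
  qed
  moreover have "h 0 = a" using k by (simp add: h_def)
  ultimately show ?thesis by (simp only: image_Un)
qed

text \<open>A constant \<open>g\<close> with value \<open>N\<close> gives \<open>N\<close> to the
  number of cycles, and \<open>g l = 1 - X^l\<close> gives the product in Zagier's formula. The
  effect of a transposition on cycles is thus worked out once for both.\<close>

definition cycle_weight :: "(nat \<Rightarrow> 'b::comm_monoid_mult) \<Rightarrow> ('a \<Rightarrow> 'a) \<Rightarrow> 'a set \<Rightarrow> 'b" where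
  "cycle_weight g f S = (\<Prod>c\<in>orbit f ` S. g (card c))"

definition other_weight :: "(nat \<Rightarrow> 'b::comm_monoid_mult) \<Rightarrow> ('a \<Rightarrow> 'a) \<Rightarrow> 'a set \<Rightarrow> 'a set \<Rightarrow> 'b" where
  "other_weight g f S C = (\<Prod>c\<in>orbit f ` S - {C}. g (card c))"

lemma permutes_permutation: "f permutes S \<Longrightarrow> finite S \<Longrightarrow> permutation f"
  by (auto simp: permutation_permutes)

lemma cycle_weight_conv_other:
  assumes "finite S" "C \<in> orbit f ` S"
  shows "cycle_weight g f S = g (card C) * other_weight g f S C"
  unfolding cycle_weight_def other_weight_def
  using assms by (intro prod.remove) auto

lemma other_orbits_disjoint:
  assumes f: "permutation f" and "c \<in> orbit f ` S - {orbit f a}"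
  shows "c \<inter> orbit f a = {}"
proof (rule ccontr)
  assume "c \<inter> orbit f a \<noteq> {}"
  then obtain z where z: "z \<in> c" "z \<in> orbit f a" by blast
  obtain x where "c = orbit f x" using assms(2) by blast
  then have "c = orbit f a" using z orbit_eq_orbit[OF f] by metis
  then show False using assms(2) by blast
qed

text \<open>Both orbits are removed by name so that one equation serves the split, where they
  coincide, and the merge, where they differ.\<close>

lemma orbit_transpose_comp_image_other:
  assumes f: "permutation f" and "b \<in> S"
  shows "orbit (transpose b a \<circ> f) ` {x \<in> S. x \<notin> orbit f a \<and> x \<notin> orbit f b} =
    orbit f ` S - {orbit f a, orbit f b}"
proof -
  have self: "x \<in> orbit f x" for x by (rule permutation_self_in_orbit[OF f])
  have iff: "x \<in> orbit f y \<longleftrightarrow> orbit f x = orbit f y" for x y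
    using self orbit_eq_orbit[OF f] by metis
  have "orbit (transpose b a \<circ> f) ` {x \<in> S. x \<notin> orbit f a \<and> x \<notin> orbit f b} =
      orbit f ` {x \<in> S. x \<notin> orbit f a \<and> x \<notin> orbit f b}"
    by (intro image_cong refl orbit_transpose_comp_other[OF f]) (auto simp: iff)
  also have "\<dots> = orbit f ` S - {orbit f a, orbit f b}"
    using iff by auto
  finally show ?thesis .
qed

lemma cycle_weight_split:
  assumes S: "finite S" and f: "f permutes S" and a: "a \<in> S"
    and j: "0 < j" "j < card (orbit f a)"
  shows "cycle_weight g (transpose ((f ^^ j) a) a \<circ> f) S =
    g j * g (card (orbit f a) - j) * other_weight g f S (orbit f a)"
proof -
  define k b where "k = card (orbit f a)" and "b = (f ^^ j) a"
  let ?f = "transpose b a \<circ> f"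
  define A B where "A = (\<lambda>t. (f ^^ t) a) ` {..<j}" and "B = (\<lambda>t. (f ^^ t) a) ` {j..<k}"
  have p: "permutation f" by (rule permutes_permutation[OF f S])
  have self: "x \<in> orbit f x" for x by (rule permutation_self_in_orbit[OF p])
  have inj: "inj_on (\<lambda>t. (f ^^ t) a) {..<k}" using orbit_enum(2)[OF p] by (simp add: k_def)
  have jk: "j < k" using j by (simp add: k_def)
  have orb: "orbit f a = A \<union> B"
    unfolding A_def B_def using jk
    by (subst orbit_enum(1)[OF p]) (simp add: image_Un[symmetric] k_def[symmetric] ivl_disj_un)
  have disj: "A \<inter> B = {}"
    unfolding A_def B_def using jk
    by (subst inj_on_image_Int[OF inj, symmetric]) auto
  have card: "card A = j" "card B = k - j"
    unfolding A_def B_def using jk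
    by (subst card_image; auto intro: inj_on_subset[OF inj])+
  have orb_f: "orbit ?f a = A" "orbit ?f b = B"
    using orbit_transpose_comp_split[OF p j] by (simp_all add: A_def B_def b_def k_def)
  have b: "b \<in> orbit f a" using funpow_in_orbit[OF self] by (simp add: b_def)
  have sub: "orbit f a \<subseteq> S" by (rule permutes_orbit_subset[OF f a])
  have bS: "b \<in> S" using b sub by blast
  have perm: "permutation ?f" using p by (intro permutation_compose permutation_swap_id)
  have f_A: "orbit ?f x = A" if "x \<in> A" for x using orbit_eq_orbit[OF perm] that orb_f by metis
  have f_B: "orbit ?f x = B" if "x \<in> B" for x using orbit_eq_orbit[OF perm] that orb_f by metis
  have ne: "A \<noteq> {}" "B \<noteq> {}" using j jk by (auto simp: A_def B_def)
  have "S = {x \<in> S. x \<notin> orbit f a \<and> x \<notin> orbit f b} \<union> A \<union> B"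
    using sub orb orbit_eq_orbit[OF p b] by auto
  then have "orbit ?f ` S = orbit ?f ` {x \<in> S. x \<notin> orbit f a \<and> x \<notin> orbit f b} \<union>
      orbit ?f ` A \<union> orbit ?f ` B" by (metis image_Un)
  also have "orbit ?f ` A = {A}" using f_A ne by auto
  also have "orbit ?f ` B = {B}" using f_B ne by auto
  also have "orbit ?f ` {x \<in> S. x \<notin> orbit f a \<and> x \<notin> orbit f b} = orbit f ` S - {orbit f a}"
    using orbit_transpose_comp_image_other[OF p bS, of a] by (simp add: orbit_eq_orbit[OF p b])
  finally have img: "orbit ?f ` S = insert A (insert B (orbit f ` S - {orbit f a}))"
    by (simp add: insert_commute comp_def)
  have "X \<notin> orbit f ` S - {orbit f a}" if "X \<subseteq> orbit f a" "X \<noteq> {}" for X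
    using other_orbits_disjoint[OF p, of X S a] that by blast
  then have notin: "A \<notin> orbit f ` S - {orbit f a}" "B \<notin> orbit f ` S - {orbit f a}"
    using ne unfolding orb by blast+
  have "A \<noteq> B" using disj ne by auto
  then show ?thesis
    using notin S unfolding b_def[symmetric] k_def[symmetric] cycle_weight_def img other_weight_def
    by (simp add: card mult.assoc)
qed

lemma cycle_weight_merge:
  assumes S: "finite S" and f: "f permutes S" and a: "a \<in> S" and b: "b \<in> S" "b \<notin> orbit f a"
  shows "cycle_weight g (transpose b a \<circ> f) S =
    g (card (orbit f a) + card (orbit f b)) * (\<Prod>c\<in>orbit f ` S - {orbit f a, orbit f b}. g (card c))"
proof -
  let ?f = "transpose b a \<circ> f"
  define C where "C = orbit f a \<union> orbit f b"
  have p: "permutation f" by (rule permutes_permutation[OF f S])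
  have self: "x \<in> orbit f x" for x by (rule permutation_self_in_orbit[OF p])
  have perm: "permutation ?f" using p by (intro permutation_compose permutation_swap_id)
  have sub: "orbit f a \<subseteq> S" "orbit f b \<subseteq> S"
    using permutes_orbit_subset[OF f] a b by auto
  have fin: "finite (orbit f a)" "finite (orbit f b)" using sub S finite_subset by auto
  have "orbit f a \<noteq> orbit f b" using self b by metis
  then have disj: "orbit f a \<inter> orbit f b = {}"
    using other_orbits_disjoint[OF p, of "orbit f a" S b] a by auto
  have orb_f: "orbit ?f a = C"
    using orbit_transpose_comp_merge[OF p b(2)] by (simp add: C_def)
  have f_C: "orbit ?f x = C" if "x \<in> C" for x using orbit_eq_orbit[OF perm] that orb_f by metis
  have aC: "a \<in> C" using self by (simp add: C_def)
  have "S = {x \<in> S. x \<notin> orbit f a \<and> x \<notin> orbit f b} \<union> C"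
    using sub by (auto simp: C_def)
  then have "orbit ?f ` S = orbit ?f ` {x \<in> S. x \<notin> orbit f a \<and> x \<notin> orbit f b} \<union> orbit ?f ` C"
    by (metis image_Un)
  also have "orbit ?f ` C = {C}" using f_C aC by auto
  finally have img: "orbit ?f ` S = insert C (orbit f ` S - {orbit f a, orbit f b})"
    unfolding orbit_transpose_comp_image_other[OF p b(1)] by (simp add: comp_def)
  have "C \<notin> orbit f ` S - {orbit f a, orbit f b}"
    using other_orbits_disjoint[OF p, of C S a] aC self[of a] by auto
  moreover have "card C = card (orbit f a) + card (orbit f b)"
    unfolding C_def using disj fin by (intro card_Un_disjoint)
  ultimately show ?thesis
    using S unfolding cycle_weight_def img by simp
qed

section \<open>Inserting and deleting a point\<close>

lemma cycle_weight_insert_fixed: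
  assumes S: "finite S" and f: "f permutes S" and p: "p \<notin> S"
  shows "cycle_weight g f (insert p S) = g 1 * cycle_weight g f S"
proof -
  have "f p = p" using f p by (rule permutes_not_in)
  then have "orbit f p = {p}" by (simp add: orbit_eq_singleton_iff)
  moreover have "{p} \<notin> orbit f ` S"
    using permutes_orbit_subset[OF f] p by blast
  ultimately show ?thesis
    using S by (simp add: cycle_weight_def)
qed

text \<open>On \<open>insert p S\<close> the point \<open>p\<close> is fixed by \<open>f\<close>, so
  this is a merge with the cycle \<open>{p}\<close>, which lengthens the cycle of \<open>a\<close>
  by one.\<close>

lemma cycle_weight_insert_transpose:
  assumes S: "finite S" and f: "f permutes S" and p: "p \<notin> S" and a: "a \<in> S"
  shows "cycle_weight g (transpose p a \<circ> f) (insert p S) =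
    g (Suc (card (orbit f a))) * other_weight g f S (orbit f a)"
proof -
  have "f p = p" using f p by (rule permutes_not_in)
  then have orb: "orbit f p = {p}" by (simp add: orbit_eq_singleton_iff)
  have sub: "orbit f x \<subseteq> S" if "x \<in> S" for x by (rule permutes_orbit_subset[OF f that])
  have "{p} \<notin> orbit f ` S" using sub p by blast
  then have "orbit f ` insert p S - {orbit f a, orbit f p} = orbit f ` S - {orbit f a}"
    by (auto simp: orb)
  then show ?thesis
    using cycle_weight_merge[of "insert p S" f a p g] assms sub[OF a] permutes_subset[OF f, of "insert p S"]
    by (auto simp: orb other_weight_def)
qed

text \<open>In cycle notation \<open>p\<close> is erased from its cycle: its predecessor is sent to
  \<open>f p\<close>, and \<open>p\<close> becomes a fixed point.\<close>

definition remove_point :: "'a \<Rightarrow> ('a \<Rightarrow> 'a) \<Rightarrow> 'a \<Rightarrow> 'a" where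
  "remove_point p f = transpose p (f p) \<circ> f"

lemma remove_point_permutes:
  assumes "f permutes insert p S"
  shows "remove_point p f permutes S"
proof -
  have "f p \<in> insert p S" using permutes_in_image[OF assms, of p] by simp
  then have "remove_point p f permutes insert p S"
    unfolding remove_point_def using assms
    by (intro permutes_compose[OF assms] permutes_swap_id) auto
  then show ?thesis
    by (rule permutes_superset) (auto simp: remove_point_def)
qed

text \<open>Erasing \<open>p\<close> loses a cycle exactly if \<open>p\<close> is a cycle by itself.
  A constant weight does not see that another cycle has become shorter.\<close>

lemma cycle_weight_const_remove_point:
  assumes S: "finite S" and p: "p \<notin> S" and f: "f permutes insert p S"
  shows "cycle_weight (\<lambda>_. N) f (insert p S) =
    (if f p = p then N else 1) * cycle_weight (\<lambda>_. N) (remove_point p f) S"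
proof (cases "f p = p")
  case True
  then show ?thesis
    using cycle_weight_insert_fixed[OF S _ p, of f] remove_point_permutes[OF f]
    by (simp add: remove_point_def)
next
  case False
  then have a: "f p \<in> S" using permutes_in_image[OF f, of p] by simp
  have "f = transpose p (f p) \<circ> remove_point p f"
    by (simp add: remove_point_def comp_assoc[symmetric])
  then show ?thesis
    using cycle_weight_insert_transpose[OF S remove_point_permutes[OF f] p a, of "\<lambda>_. N"]
      cycle_weight_conv_other[OF S, of "orbit (remove_point p f) (f p)" "remove_point p f" "\<lambda>_. N"] a False
    by simp
qed

section \<open>Summing over the transpositions that move a given point\<close>

lemma permutes_sum_split_orbits:
  assumes S: "finite S" and f: "f permutes S" and a: "a \<in> S"
  shows "(\<Sum>i\<in>S - {a}. h i) =
    (\<Sum>j\<in>{0<..<card (orbit f a)}. h ((f ^^ j) a)) + (\<Sum>c\<in>orbit f ` S - {orbit f a}. \<Sum>i\<in>c. h i)"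
proof -
  have p: "permutation f" by (rule permutes_permutation[OF f S])
  have self: "x \<in> orbit f x" for x by (rule permutation_self_in_orbit[OF p])
  have sub: "orbit f x \<subseteq> S" if "x \<in> S" for x by (rule permutes_orbit_subset[OF f that])
  note k = orbit_enum[OF p, of a]
  let ?R = "orbit f ` S - {orbit f a}"
  define U where "U = \<Union>?R"
  have "x \<in> U" if "x \<in> S" "x \<notin> orbit f a" for x
    using that self unfolding U_def by blast
  moreover have "U \<subseteq> S" "orbit f a \<subseteq> S" using sub a by (auto simp: U_def)
  moreover have "U \<inter> orbit f a = {}"
    using other_orbits_disjoint[OF p, of _ S a] unfolding U_def by blast
  ultimately have "S - {a} = (orbit f a - {a}) \<union> U" "(orbit f a - {a}) \<inter> U = {}"
    "finite U" "finite (orbit f a - {a})"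
    using self[of a] S finite_subset[OF _ S] by blast+
  then have "(\<Sum>i\<in>S - {a}. h i) = (\<Sum>i\<in>orbit f a - {a}. h i) + (\<Sum>i\<in>U. h i)"
    by (simp add: sum.union_disjoint)
  also have "(\<Sum>i\<in>U. h i) = (\<Sum>c\<in>?R. \<Sum>i\<in>c. h i)"
    unfolding U_def
  proof (rule sum.Union_disjoint[unfolded comp_def])
    show "\<forall>c\<in>?R. finite c" using sub finite_subset[OF _ S] by auto
    show "\<forall>c\<in>?R. \<forall>d\<in>?R. c \<noteq> d \<longrightarrow> c \<inter> d = {}"
      using other_orbits_disjoint[OF p] by blast
  qed
  also have "(\<Sum>i\<in>orbit f a - {a}. h i) = (\<Sum>j\<in>{0<..<card (orbit f a)}. h ((f ^^ j) a))"
  proof (rule sum.reindex_cong)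
    show "inj_on (\<lambda>j. (f ^^ j) a) {0<..<card (orbit f a)}"
      by (rule inj_on_subset[OF k(2)]) auto
    have "{..<card (orbit f a)} = insert 0 {0<..<card (orbit f a)}" using k(4) by auto
    then have "orbit f a = insert a ((\<lambda>j. (f ^^ j) a) ` {0<..<card (orbit f a)})"
      using k(1) by (metis (no_types, lifting) funpow_0 image_insert)
    moreover have "a \<notin> (\<lambda>j. (f ^^ j) a) ` {0<..<card (orbit f a)}"
      using inj_onD[OF k(2), of 0] k(4) by fastforce
    ultimately show "orbit f a - {a} = (\<lambda>j. (f ^^ j) a) ` {0<..<card (orbit f a)}"
      by (metis Diff_insert_absorb)
  qed simp
  finally show ?thesis .
qed

text \<open>A point \<open>i = (f ^^ j) a\<close> with \<open>0 < j < k\<close> splits the cycle of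
  \<open>a\<close> into lengths \<open>j\<close> and \<open>k - j\<close>. A point of another cycle
  \<open>c\<close> merges \<open>c\<close> with it; all \<open>card c\<close> points of
  \<open>c\<close> give the same weight, hence the factor.\<close>

lemma sum_cycle_weight_transpose:
  fixes g :: "nat \<Rightarrow> 'b::comm_semiring_1"
  assumes S: "finite S" and f: "f permutes S" and a: "a \<in> S"
  defines "k \<equiv> card (orbit f a)"
  shows "(\<Sum>i\<in>S - {a}. cycle_weight g (transpose i a \<circ> f) S) =
    (\<Sum>j\<in>{0<..<k}. g j * g (k - j)) * other_weight g f S (orbit f a) +
    (\<Sum>c\<in>orbit f ` S - {orbit f a}. of_nat (card c) * g (k + card c) *
       (\<Prod>d\<in>orbit f ` S - {orbit f a} - {c}. g (card d)))"
proof -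
  have p: "permutation f" by (rule permutes_permutation[OF f S])
  have self: "x \<in> orbit f x" for x by (rule permutation_self_in_orbit[OF p])
  have merge: "cycle_weight g (transpose i a \<circ> f) S = g (k + card c) *
      (\<Prod>d\<in>orbit f ` S - {orbit f a} - {c}. g (card d))"
    if c: "c \<in> orbit f ` S - {orbit f a}" and i: "i \<in> c" for c i
  proof -
    have "orbit f i = c" using c i orbit_eq_orbit[OF p] by auto
    moreover have "i \<in> S" using c i permutes_orbit_subset[OF f] by auto
    moreover have "i \<notin> orbit f a" using other_orbits_disjoint[OF p c] i by auto
    ultimately show ?thesis
      using cycle_weight_merge[OF S f a, of i g] by (simp add: k_def Diff_insert2[symmetric] insert_commute)
  qed
  have "(\<Sum>i\<in>S - {a}. cycle_weight g (transpose i a \<circ> f) S) =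
    (\<Sum>j\<in>{0<..<k}. g j * g (k - j) * other_weight g f S (orbit f a)) +
    (\<Sum>c\<in>orbit f ` S - {orbit f a}. \<Sum>i\<in>c. g (k + card c) *
       (\<Prod>d\<in>orbit f ` S - {orbit f a} - {c}. g (card d)))"
    unfolding permutes_sum_split_orbits[OF S f a]
    by (intro arg_cong2[where f = "(+)"] sum.cong refl)
      (simp_all add: cycle_weight_split[OF S f a] merge k_def)
  then show ?thesis
    by (simp add: sum_distrib_right mult.assoc)
qed

section \<open>Sums over full cycles\<close>

definition full_cycles :: "'a set \<Rightarrow> ('a \<Rightarrow> 'a) set" where
  "full_cycles S = {cycle_of_list xs | xs. distinct xs \<and> set xs = S}"

lemma full_cycles_permutes: "c \<in> full_cycles S \<Longrightarrow> c permutes S"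
  using cycle_permutes by (auto simp: full_cycles_def)

lemma full_cycles_singleton: "full_cycles {p} = {id}"
proof -
  have "xs = [p]" if "distinct xs" "set xs = {p}" for xs :: "'a list"
    using that by (cases xs) (auto simp: subset_singleton_iff)
  then show ?thesis
    unfolding full_cycles_def by (force intro: exI[of _ "[p]"])
qed

text \<open>Rotating a list does not change its cycle, so any chosen point can be put first.\<close>

lemma full_cycles_start:
  assumes "c \<in> full_cycles S" "p \<in> S"
  obtains xs where "distinct (p # xs)" "set (p # xs) = S" "c = cycle_of_list (p # xs)"
proof -
  obtain ys where ys: "distinct ys" "set ys = S" "c = cycle_of_list ys"
    using assms(1) by (auto simp: full_cycles_def)
  obtain us vs where uv: "ys = us @ p # vs" using assms(2) ys(2) split_list by metis
  have rot: "rotate (length us) ys = p # vs @ us" by (simp add: uv rotate_append)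
  have "c = cycle_of_list (p # vs @ us)"
    using cycle_of_list_rotate_independent[OF ys(1), of "length us"] ys(3) rot by simp
  moreover have "distinct (p # vs @ us)" "set (p # vs @ us) = S"
    using ys uv by auto
  ultimately show ?thesis by (rule that[rotated 2])
qed

text \<open>By the recursion of \<open>cycle_of_list\<close>, prepending \<open>p\<close> to a list
  that starts with \<open>i\<close> composes its cycle with \<open>transpose p i\<close>. Conversely
  \<open>i\<close> is recovered as the image of \<open>p\<close>, and then \<open>c\<close> by
  cancelling the transposition.\<close>

lemma full_cycles_insert:
  assumes p: "p \<notin> S" and "S \<noteq> {}"
  shows "bij_betw (\<lambda>(i, c). transpose i p \<circ> c) (S \<times> full_cycles S) (full_cycles (insert p S))"
  unfolding bij_betw_def
proof
  show "inj_on (\<lambda>(i, c). transpose i p \<circ> c) (S \<times> full_cycles S)"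
  proof (rule inj_onI, clarify)
    fix i j c d
    assume i: "i \<in> S" "c \<in> full_cycles S" and j: "j \<in> S" "d \<in> full_cycles S"
      and eq: "transpose i p \<circ> c = transpose j p \<circ> d"
    have "c p = p" "d p = p"
      using i j full_cycles_permutes permutes_not_in[OF _ p] by blast+
    then have "i = j" using fun_cong[OF eq, of p] by simp
    moreover have "c = transpose i p \<circ> (transpose i p \<circ> c)" "d = transpose j p \<circ> (transpose j p \<circ> d)"
      by (simp_all add: comp_assoc[symmetric])
    ultimately show "i = j \<and> c = d" using eq by metis
  qed
  show "(\<lambda>(i, c). transpose i p \<circ> c) ` (S \<times> full_cycles S) = full_cycles (insert p S)"
  proof (intro equalityI subsetI)
    fix f assume "f \<in> (\<lambda>(i, c). transpose i p \<circ> c) ` (S \<times> full_cycles S)"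
    then obtain i c where i: "i \<in> S" and c: "c \<in> full_cycles S" and f: "f = transpose i p \<circ> c"
      by auto
    obtain xs where xs: "distinct (i # xs)" "set (i # xs) = S" "c = cycle_of_list (i # xs)"
      using full_cycles_start[OF c i] by blast
    have "f = cycle_of_list (p # i # xs)" by (simp add: f xs(3) transpose_commute)
    moreover have "distinct (p # i # xs)" "set (p # i # xs) = insert p S" using xs p by auto
    ultimately show "f \<in> full_cycles (insert p S)" unfolding full_cycles_def by blast
  next
    fix f assume f: "f \<in> full_cycles (insert p S)"
    obtain ys where ys: "distinct (p # ys)" "set (p # ys) = insert p S" "f = cycle_of_list (p # ys)"
      using full_cycles_start[OF f, of p] by blast
    have S: "set ys = S" using ys p by auto
    then obtain i xs where ix: "ys = i # xs" using \<open>S \<noteq> {}\<close> by (cases ys) auto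
    have "f = transpose i p \<circ> cycle_of_list ys" by (simp add: ys(3) ix transpose_commute)
    moreover have "cycle_of_list ys \<in> full_cycles S" using ys S by (auto simp: full_cycles_def)
    moreover have "i \<in> S" using S ix by auto
    ultimately show "f \<in> (\<lambda>(i, c). transpose i p \<circ> c) ` (S \<times> full_cycles S)" by auto
  qed
qed

text \<open>Conjugating a list cycle by \<pi> applies \<pi> to the entries of the list. So \<pi>
  sends each entry of one list to the entry of the other at the same index, and is the identity off
  \<open>S\<close>.\<close>

lemma full_cycles_conjugate:
  assumes "c \<in> full_cycles S" "d \<in> full_cycles S"
  obtains \<pi> where "\<pi> permutes S" "d = \<pi> \<circ> c \<circ> inv \<pi>"
proof -
  obtain xs where xs: "distinct xs" "set xs = S" "c = cycle_of_list xs"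
    using assms(1) by (auto simp: full_cycles_def)
  obtain ys where ys: "distinct ys" "set ys = S" "d = cycle_of_list ys"
    using assms(2) by (auto simp: full_cycles_def)
  have len: "length xs = length ys" using xs ys by (metis distinct_card)
  have xs_bij: "bij_betw ((!) xs) {..<length xs} S" using bij_betw_nth[OF xs(1)] xs(2) by auto
  have ys_bij: "bij_betw ((!) ys) {..<length xs} S" using bij_betw_nth[OF ys(1)] ys(2) len by auto
  define \<phi> where "\<phi> = (!) ys \<circ> the_inv_into {..<length xs} ((!) xs)"
  define \<pi> where "\<pi> x = (if x \<in> S then \<phi> x else x)" for x
  have "bij_betw \<phi> S S"
    unfolding \<phi>_def by (rule bij_betw_trans[OF bij_betw_the_inv_into[OF xs_bij] ys_bij])
  then have "bij_betw \<pi> S S"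
    by (rule bij_betw_cong[THEN iffD1, rotated]) (simp add: \<pi>_def)
  then have \<pi>: "\<pi> permutes S" by (rule bij_imp_permutes) (simp add: \<pi>_def)
  have "map \<pi> xs = ys"
  proof (rule nth_equalityI)
    fix i assume "i < length (map \<pi> xs)"
    then have i: "i < length xs" by simp
    then have "the_inv_into {..<length xs} ((!) xs) (xs ! i) = i"
      using xs_bij by (intro the_inv_into_f_f) (auto simp: bij_betw_def)
    then show "map \<pi> xs ! i = ys ! i"
      using i nth_mem[OF i] xs(2) by (simp add: \<pi>_def \<phi>_def)
  qed (simp add: len)
  then have "d = \<pi> \<circ> c \<circ> inv \<pi>"
    using conjugation_of_cycle[OF xs(1) permutes_bij[OF \<pi>]] xs(3) ys(3) by simp
  with \<pi> show ?thesis by (rule that)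
qed

section \<open>Recursion for the sums over full cycles\<close>

definition cycle_sum :: "'b::comm_semiring_1 \<Rightarrow> 'a set \<Rightarrow> ('a \<Rightarrow> 'a) \<Rightarrow> 'b" where
  "cycle_sum N S f = (\<Sum>c\<in>full_cycles S. cycle_weight (\<lambda>_. N) (inv c \<circ> f) S)"

text \<open>Writing a full cycle as \<open>(i p) c\<close> turns the summand into the weight of
  \<open>inv c \<circ> h\<close> with \<open>h = (i p) f\<close>. Then \<open>p\<close> is erased
  from it: \<open>p\<close> is fixed there exactly if \<open>f p = i\<close>, and what remains is a
  summand of \<open>cycle_sum\<close> over \<open>S\<close>.\<close>

lemma cycle_sum_insert:
  assumes S: "finite S" "S \<noteq> {}" and p: "p \<notin> S" and f: "f permutes insert p S"
  shows "cycle_sum N (insert p S) f =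
    (\<Sum>i\<in>S. (if f p = i then N else 1) * cycle_sum N S (remove_point p (transpose i p \<circ> f)))"
proof -
  have weight: "cycle_weight (\<lambda>_. N) (inv (transpose i p \<circ> c) \<circ> f) (insert p S) =
      (if f p = i then N else 1) * cycle_weight (\<lambda>_. N) (inv c \<circ> remove_point p (transpose i p \<circ> f)) S"
    if i: "i \<in> S" and c: "c \<in> full_cycles S" for i c
  proof -
    have cS: "c permutes S" by (rule full_cycles_permutes[OF c])
    then have bij: "bij c" by (rule permutes_bij)
    define h where "h = transpose i p \<circ> f"
    have inv_cp: "inv c permutes S" by (rule permutes_inv[OF cS])
    have icp: "inv c p = p" by (rule permutes_not_in[OF inv_cp p])
    have cp: "c p = p" by (rule permutes_not_in[OF cS p])
    have eq: "inv (transpose i p \<circ> c) \<circ> f = inv c \<circ> h"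
      by (simp add: o_inv_distrib[OF bij_transpose bij] h_def comp_assoc)
    have h: "h permutes insert p S"
      unfolding h_def using i by (intro permutes_compose[OF f] permutes_swap_id) auto
    have hp: "inv c \<circ> h permutes insert p S"
      using permutes_compose[OF h permutes_subset[OF inv_cp]] by blast
    have "(inv c \<circ> h) p = p \<longleftrightarrow> f p = i"
      using bij_inv_eq_iff[OF bij, of p "h p"] cp i p by (auto simp: h_def transpose_def)
    \<comment> \<open>Since \<open>inv c\<close> fixes \<open>p\<close>, moving it past the
      transposition of \<open>p\<close> and \<open>h p\<close> only turns \<open>h p\<close> into
      \<open>inv c (h p)\<close>.\<close>
    moreover have "remove_point p (inv c \<circ> h) = inv c \<circ> remove_point p h"
    proof
      fix x
      have bij': "bij (inv c)" using bij by (rule bij_imp_bij_inv)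
      show "remove_point p (inv c \<circ> h) x = (inv c \<circ> remove_point p h) x"
        using transpose_apply_commute[OF bij', of p "inv c (h p)" "h x"] cp bij
        by (simp add: remove_point_def inv_inv_eq bij_is_inj surj_f_inv_f[OF bij_is_surj])
    qed
    ultimately show ?thesis
      unfolding eq using cycle_weight_const_remove_point[OF S(1) p hp, of N]
      by (simp add: h_def del: o_apply)
  qed
  have "cycle_sum N (insert p S) f =
      (\<Sum>(i, c)\<in>S \<times> full_cycles S. cycle_weight (\<lambda>_. N) (inv (transpose i p \<circ> c) \<circ> f) (insert p S))"
    unfolding cycle_sum_def
    by (subst sum.reindex_bij_betw[OF full_cycles_insert[OF p S(2)], symmetric])
      (simp add: case_prod_unfold)
  also have "\<dots> = (\<Sum>i\<in>S. (if f p = i then N else 1) * cycle_sum N S (remove_point p (transpose i p \<circ> f)))"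
    unfolding cycle_sum_def
    by (subst sum.cartesian_product[symmetric]) (simp add: weight sum_distrib_left)
  finally show ?thesis .
qed

text \<open>As \<open>f\<close> fixes \<open>p\<close>, erasing \<open>p\<close> from
  \<open>(i p) f\<close> undoes the transposition for every \<open>i\<close>. The factor
  \<open>N\<close> never occurs because \<open>f p = p\<close> lies outside
  \<open>S\<close>.\<close>

lemma cycle_sum_insert_fixed:
  assumes S: "finite S" "S \<noteq> {}" and p: "p \<notin> S" and f: "f permutes S"
  shows "cycle_sum N (insert p S) f = of_nat (card S) * cycle_sum N S f"
proof -
  have fp: "f p = p" by (rule permutes_not_in[OF f p])
  have "remove_point p (transpose i p \<circ> f) = f" for i
    by (simp add: remove_point_def fp transpose_commute comp_assoc[symmetric])
  then have "(\<Sum>i\<in>S. (if f p = i then N else 1) * cycle_sum N S (remove_point p (transpose i p \<circ> f))) =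
      (\<Sum>i\<in>S. cycle_sum N S f)"
    using fp p by (intro sum.cong) auto
  then show ?thesis
    using cycle_sum_insert[OF S p, of f N] permutes_subset[OF f, of "insert p S"] by auto
qed

text \<open>With \<open>h = (p a) f\<close> we have \<open>h p = a\<close>. So \<open>i = a\<close>
  carries the factor \<open>N\<close> and leaves \<open>f\<close>; for other \<open>i\<close>,
  erasing \<open>p\<close> conjugates \<open>(i p)\<close> by \<open>(p a)\<close>, which is
  \<open>(i a)\<close>.\<close>

lemma cycle_sum_insert_transpose:
  assumes S: "finite S" "S \<noteq> {}" and p: "p \<notin> S" and f: "f permutes S" and a: "a \<in> S"
  shows "cycle_sum N (insert p S) (transpose p a \<circ> f) =
    N * cycle_sum N S f + (\<Sum>i\<in>S - {a}. cycle_sum N S (transpose i a \<circ> f))"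
proof -
  define h where "h = transpose p a \<circ> f"
  have fp: "f p = p" by (rule permutes_not_in[OF f p])
  have hp: "h p = a" by (simp add: h_def fp)
  have h: "h permutes insert p S"
    unfolding h_def using a
    by (intro permutes_compose[OF permutes_subset[OF f]] permutes_swap_id) auto
  have rem_a: "remove_point p (transpose a p \<circ> h) = f"
    by (simp add: remove_point_def fp hp h_def transpose_commute comp_assoc[symmetric])
  have rem: "remove_point p (transpose i p \<circ> h) = transpose i a \<circ> f" if "i \<in> S - {a}" for i
  proof -
    have ne: "i \<noteq> p" "a \<noteq> p" "i \<noteq> a" using that a p by auto
    then have "remove_point p (transpose i p \<circ> h) = (transpose p a \<circ> transpose i p \<circ> transpose p a) \<circ> f"
      by (simp add: remove_point_def hp h_def fp comp_assoc)
    also have "transpose p a \<circ> transpose i p \<circ> transpose p a = transpose i a"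
      using transpose_comp_triple[of a i p] ne by (simp add: transpose_commute)
    finally show ?thesis .
  qed
  have "(\<Sum>i\<in>S - {a}. (if a = i then N else 1) * cycle_sum N S (remove_point p (transpose i p \<circ> h))) =
      (\<Sum>i\<in>S - {a}. cycle_sum N S (transpose i a \<circ> f))"
    by (intro sum.cong refl) (auto simp: rem)
  then show ?thesis
    unfolding h_def[symmetric] cycle_sum_insert[OF S p h] hp
    by (subst sum.remove[OF S(1) a]) (simp add: rem_a)
qed

text \<open>Zagier's generating function of the numbers \<open>cycle_sum N S f\<close> for \<open>N \<ge> 1\<close>; the shift by one
  makes multiplication by \<open>N\<close> the operator \<open>F \<mapsto> (X F)'\<close>.\<close>

definition cycle_gf :: "'a set \<Rightarrow> ('a \<Rightarrow> 'a) \<Rightarrow> rat fps" where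
  "cycle_gf S f = Abs_fps (\<lambda>N. cycle_sum (of_nat (Suc N)) S f)"

section \<open>Power series identities and Zagier's formula\<close>

lemma fps_deriv_one_minus_X_power:
  "fps_X * fps_deriv (1 - fps_X ^ k :: rat fps) = - of_nat k * fps_X ^ k"
proof (cases k)
  case (Suc n)
  have "fps_deriv (1 - fps_X ^ k :: rat fps) = - (of_nat k * fps_X ^ n)"
    by (simp add: Suc fps_deriv_power' del: power_Suc of_nat_Suc)
  then show ?thesis by (simp add: Suc mult_ac del: of_nat_Suc)
qed simp

text \<open>The Leibniz rule for \<open>X d/dX\<close>. It yields one term per cycle
  \<open>c\<close>, in the same shape as the contribution of the transpositions that merge
  \<open>c\<close>, with which it is combined later.\<close>

lemma fps_deriv_prod_one_minus_X_power:
  assumes "finite C"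
  shows "fps_X * fps_deriv (\<Prod>c\<in>C. 1 - fps_X ^ card c :: rat fps) =
    - (\<Sum>c\<in>C. of_nat (card c) * fps_X ^ card c * (\<Prod>d\<in>C - {c}. 1 - fps_X ^ card d))"
  using assms
proof (induction C rule: finite_induct)
  case (insert x C)
  let ?w = "\<lambda>c. 1 - fps_X ^ card c :: rat fps"
  have eq1: "(\<Sum>c\<in>C. of_nat (card c) * fps_X ^ card c * prod ?w (insert x C - {c})) =
      ?w x * (\<Sum>c\<in>C. of_nat (card c) * fps_X ^ card c * prod ?w (C - {c}))"
    unfolding sum_distrib_left
  proof (rule sum.cong)
    fix c assume "c \<in> C"
    then have "insert x C - {c} = insert x (C - {c})" using insert.hyps by auto
    then show "of_nat (card c) * fps_X ^ card c * prod ?w (insert x C - {c}) =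
        ?w x * (of_nat (card c) * fps_X ^ card c * prod ?w (C - {c}))"
      using insert.hyps by (simp add: mult_ac)
  qed simp
  have deriv: "fps_X * fps_deriv (prod ?w (insert x C)) =
      (fps_X * fps_deriv (?w x)) * prod ?w C + ?w x * (fps_X * fps_deriv (prod ?w C))"
    using insert.hyps by (simp add: algebra_simps)
  have eq2: "insert x C - {x} = C" using insert.hyps by auto
  show ?case
    unfolding deriv insert.IH fps_deriv_one_minus_X_power sum.insert[OF insert.hyps] eq1 eq2
    by (simp add: algebra_simps)
qed simp

text \<open>Each product expands to \<open>1 + X^k - X^j - X^(k-j)\<close>. The factor
  \<open>1 - X\<close> sums the geometric series without division. This is the contribution of the
  splitting transpositions.\<close>

lemma sum_one_minus_power_split:
  fixes X :: "'b::comm_ring_1"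
  assumes "0 < k"
  shows "(1 - X) * (\<Sum>j\<in>{0<..<k}. (1 - X ^ j) * (1 - X ^ (k - j))) =
    (1 - X) * of_nat (k - 1) * (1 + X ^ k) - 2 * (X - X ^ k)"
proof -
  have eq: "{0<..<k} = {1..<k}" by auto
  have geo: "(1 - X) * (\<Sum>j\<in>{1..<k}. X ^ j) = X - X ^ k"
    using assms
  proof (induction k rule: nat_induct_non_zero)
    case (Suc n)
    have "(\<Sum>j\<in>{1..<Suc n}. X ^ j) = (\<Sum>j\<in>{1..<n}. X ^ j) + X ^ n"
      using Suc.hyps by (intro sum.atLeastLessThan_Suc) simp
    then show ?case using Suc.IH by (simp add: distrib_left left_diff_distrib)
  qed simp
  have rev: "(\<Sum>j\<in>{1..<k}. X ^ (k - j)) = (\<Sum>j\<in>{1..<k}. X ^ j)"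
    by (rule sum.reindex_bij_witness[of _ "\<lambda>j. k - j" "\<lambda>j. k - j"]) auto
  have "(\<Sum>j\<in>{1..<k}. (1 - X ^ j) * (1 - X ^ (k - j))) =
      (\<Sum>j\<in>{1..<k}. (1 + X ^ k) - X ^ j - X ^ (k - j))"
    by (intro sum.cong) (auto simp: algebra_simps power_add[symmetric])
  also have "\<dots> = of_nat (k - 1) * (1 + X ^ k) - 2 * (\<Sum>j\<in>{1..<k}. X ^ j)"
    by (simp add: sum_subtractf rev del: One_nat_def)
  finally have "(1 - X) * (\<Sum>j\<in>{1..<k}. (1 - X ^ j) * (1 - X ^ (k - j))) =
      (1 - X) * of_nat (k - 1) * (1 + X ^ k) - 2 * ((1 - X) * (\<Sum>j\<in>{1..<k}. X ^ j))"
    by (simp only: right_diff_distrib mult.assoc mult.left_commute[of _ 2])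
  then show ?thesis unfolding eq geo .
qed

lemma card_other_orbits:
  assumes S: "finite S" and f: "f permutes S" and a: "a \<in> S"
  shows "(\<Sum>c\<in>orbit f ` S - {orbit f a}. card c) + card (orbit f a) = card S"
proof -
  have pf: "permutation f" by (rule permutes_permutation[OF f S])
  have "(\<Sum>i\<in>S - {a}. 1) =
    (\<Sum>j\<in>{0<..<card (orbit f a)}. 1) + (\<Sum>c\<in>orbit f ` S - {orbit f a}. \<Sum>i\<in>c. 1::nat)"
    by (rule permutes_sum_split_orbits[OF S f a])
  moreover have "0 < card S" using S a by (auto simp: card_gt_0_iff)
  ultimately show ?thesis
    using orbit_enum(4)[OF pf, of a] S a by simp
qed

text \<open>The identity is the only full cycle and contributes \<open>N\<close> at index
  \<open>N - 1\<close>, so the coefficients are 1, 2, 3, and so on.\<close>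

lemma cycle_gf_singleton:
  assumes "f permutes {p}"
  shows "cycle_gf {p} f * (1 - fps_X) ^ 2 = 1"
proof -
  have f: "f = id" using assms by (simp add: permutes_sing)
  have "cycle_gf {p} f = Abs_fps (\<lambda>n. of_nat (n + 1))"
    by (simp add: cycle_gf_def cycle_sum_def full_cycles_singleton f cycle_weight_def)
  also have "\<dots> = inverse ((1 - fps_X) ^ 2)"
    by (rule fps_one_over_one_minus_fps_X_squared[symmetric])
  finally show ?thesis
    by (simp add: inverse_mult_eq_1)
qed

lemma cycle_gf_insert_fixed:
  assumes "finite S" "S \<noteq> {}" "p \<notin> S" "f permutes S"
  shows "cycle_gf (insert p S) f = of_nat (card S) * cycle_gf S f"
  by (rule fps_ext) (simp add: cycle_gf_def cycle_sum_insert_fixed[OF assms] fps_of_nat[symmetric])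

lemma cycle_gf_insert_transpose:
  assumes "finite S" "S \<noteq> {}" "p \<notin> S" "f permutes S" "a \<in> S"
  shows "cycle_gf (insert p S) (transpose p a \<circ> f) =
    fps_deriv (fps_X * cycle_gf S f) + (\<Sum>i\<in>S - {a}. cycle_gf S (transpose i a \<circ> f))"
  by (rule fps_ext) (simp add: cycle_gf_def cycle_sum_insert_transpose[OF assms] fps_sum_nth distrib_right)

lemma cycle_gf_deriv_identity:
  fixes U :: "'b::comm_ring_1"
  assumes "U * (- M * P) + U' * W = F * (G * D' + G' * D)"
  shows "q * U' * W - M * q * U * P = F * ((q * G') * D + G * (q * D'))"
proof -
  have "q * U' * W - M * q * U * P = q * (U * (- M * P) + U' * W)" by (simp add: algebra_simps)
  also have "\<dots> = F * ((q * G') * D + G * (q * D'))" unfolding assms by (simp add: algebra_simps)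
  finally show ?thesis .
qed

text \<open>The arithmetic of the induction step. Here \<open>q\<close> is \<open>X\<close>,
  \<open>K = q^k\<close> and \<open>P = (1 - q)^(m+1)\<close>; \<open>U\<close> and \<open>V\<close>
  are the series of \<open>r\<close> and of all \<open>(i a) r\<close>; \<open>Q\<close> collects
  splits, \<open>Z\<close> merges, and \<open>E\<close> the terms of the derivative of
  \<open>D\<close>. Note that \<open>U + q * U'\<close> is the derivative of
  \<open>q * U\<close>.\<close>

lemma cycle_gf_step_identity:
  fixes U :: "'b::idom"
  assumes "U * (P * (1 - q)) = F * ((1 - K) * D)"
    and "q * U' * (P * (1 - q)) - (m + 2) * q * U * P = F * (- k * K * D - (1 - K) * E)"
    and "V * (P * (1 - q)) = F * (Q * D + Z)"
    and "Z - (1 - K) * E = (m - k) * D"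
    and "(1 - q) * Q = (1 - q) * (k - 1) * (1 + K) - 2 * (q - K)"
  shows "(U + q * U' + V) * (P * (1 - q) * (1 - q)) = m * F * (1 - q * K) * D"
  using assms by algebra

theorem cycle_gf_eq:
  assumes "finite S" "S \<noteq> {}" "f permutes S"
  shows "cycle_gf S f * (1 - fps_X) ^ (card S + 2) =
    fact (card S - 1) * cycle_weight (\<lambda>k. 1 - fps_X ^ k) f S"
  using assms
proof (induction S arbitrary: f rule: finite_ne_induct)
  case (singleton p)
  have f: "f = id" using singleton by (simp add: permutes_sing)
  have "orbit f p = {p}" by (simp add: orbit_eq_singleton_iff f)
  then show ?case
    using cycle_gf_singleton[OF singleton] by (simp add: cycle_weight_def power2_eq_square mult.assoc[symmetric])
next
  case (insert p S)
  define m where "m = card S"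
  have S: "finite S" "S \<noteq> {}" and p: "p \<notin> S" and f: "f permutes insert p S"
    using insert by auto
  have m: "0 < m" using S by (simp add: m_def card_gt_0_iff)
  have card: "card (insert p S) = Suc m" using S p by (simp add: m_def)
  define F where "F = (fact (m - 1) :: rat fps)"
  have fact_m: "fact m = of_nat m * F" using m by (simp add: F_def fact_reduce)
  let ?w = "\<lambda>k. 1 - fps_X ^ k :: rat fps"
  show ?case
  proof (cases "f p = p")
    case True
    then have fS: "f permutes S" using remove_point_permutes[OF f] by (simp add: remove_point_def)
    show ?thesis
      using insert.IH[OF fS]
      by (simp add: card cycle_gf_insert_fixed[OF S p fS] cycle_weight_insert_fixed[OF S(1) fS p]
        fact_m m_def[symmetric] F_def mult_ac)
  next
    case False
    define a r where "a = f p" and "r = remove_point p f"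
    define k where "k = card (orbit r a)"
    have a: "a \<in> S" using permutes_in_image[OF f, of p] False by (simp add: a_def)
    have r: "r permutes S" unfolding r_def by (rule remove_point_permutes[OF f])
    have f_eq: "f = transpose p a \<circ> r"
      by (simp add: r_def a_def remove_point_def comp_assoc[symmetric])
    have k: "0 < k" unfolding k_def by (rule orbit_enum(4)[OF permutes_permutation[OF r S(1)]])
    define C where "C = orbit r ` S - {orbit r a}"
    have C: "finite C" using S by (simp add: C_def)
    define D where "D = other_weight ?w r S (orbit r a)"
    have D: "D = (\<Prod>c\<in>C. ?w (card c))" by (simp add: D_def other_weight_def C_def)
    define q where "q = (fps_X :: rat fps)"
    define E where "E c = (\<Prod>d\<in>C - {c}. ?w (card d))" for c
    have DE: "D = ?w (card c) * E c" if "c \<in> C" for c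
      unfolding D E_def by (rule prod.remove[OF C that])
    define E1 where "E1 = (\<Sum>c\<in>C. of_nat (card c) * q ^ card c * E c)"
    define Z where "Z = (\<Sum>c\<in>C. of_nat (card c) * ?w (k + card c) * E c)"
    define Q where "Q = (\<Sum>j\<in>{0<..<k}. ?w j * ?w (k - j))"
    define U where "U = cycle_gf S r"
    define V where "V = (\<Sum>i\<in>S - {a}. cycle_gf S (transpose i a \<circ> r))"
    \<comment> \<open>One power less than in the induction hypothesis, because differentiating
      \<open>(1 - X)^(m+2)\<close> lowers the exponent by one.\<close>
    define P where "P = (1 - q) ^ (m + 1)"
    have P: "(1 - q) ^ (m + 2) = P * (1 - q)" by (simp add: P_def)
    have H1: "U * (P * (1 - q)) = F * ((1 - q ^ k) * D)"
      using insert.IH[OF r] cycle_weight_conv_other[OF S(1), of "orbit r a" r ?w] a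
      unfolding P[symmetric] by (simp add: U_def m_def q_def F_def D_def k_def)
    have dP: "fps_deriv (P * (1 - q)) = - of_nat (m + 2) * P"
      unfolding P[symmetric] fps_deriv_power' by (simp add: q_def P_def)
    have dF: "fps_deriv F = 0"
      unfolding F_def by (metis fps_deriv_of_nat of_nat_fact)
    have dL: "fps_deriv (U * (P * (1 - q))) = U * (- of_nat (m + 2) * P) + fps_deriv U * (P * (1 - q))"
      by (simp only: fps_deriv_mult[of U] dP)
    have dR: "fps_deriv (F * ((1 - q ^ k) * D)) =
        F * ((1 - q ^ k) * fps_deriv D + fps_deriv (1 - q ^ k) * D)"
      by (simp only: fps_deriv_mult[of F] fps_deriv_mult[of "1 - q ^ k"] dF mult_zero_left add_0_right)
    \<comment> \<open>The induction hypothesis \<open>H1\<close> is differentiated; multiplied by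
      \<open>q\<close>, it gives access to the term \<open>q * fps_deriv U\<close> of the
      recursion.\<close>
    have "U * (- of_nat (m + 2) * P) + fps_deriv U * (P * (1 - q)) =
        F * ((1 - q ^ k) * fps_deriv D + fps_deriv (1 - q ^ k) * D)"
      using H1 dL dR by metis
    then have "q * fps_deriv U * (P * (1 - q)) - of_nat (m + 2) * q * U * P =
        F * ((q * fps_deriv (1 - q ^ k)) * D + (1 - q ^ k) * (q * fps_deriv D))"
      by (rule cycle_gf_deriv_identity)
    then have H2: "q * fps_deriv U * (P * (1 - q)) - of_nat (m + 2) * q * U * P =
        F * (- of_nat k * q ^ k * D - (1 - q ^ k) * E1)"
      unfolding q_def fps_deriv_one_minus_X_power D fps_deriv_prod_one_minus_X_power[OF C]
      by (simp add: E1_def E_def q_def)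
    have H3: "V * (P * (1 - q)) = F * (Q * D + Z)"
    proof -
      have "V * (P * (1 - q)) = (\<Sum>i\<in>S - {a}. F * cycle_weight ?w (transpose i a \<circ> r) S)"
        unfolding V_def sum_distrib_right
      proof (rule sum.cong)
        fix i assume "i \<in> S - {a}"
        then have "transpose i a \<circ> r permutes S"
          using a by (intro permutes_compose[OF r] permutes_swap_id) auto
        from insert.IH[OF this]
        show "cycle_gf S (transpose i a \<circ> r) * (P * (1 - q)) = F * cycle_weight ?w (transpose i a \<circ> r) S"
          unfolding P[symmetric] by (simp add: m_def q_def F_def comp_def)
      qed simp
      then show ?thesis
        using sum_cycle_weight_transpose[OF S(1) r a, of ?w]
        by (simp add: sum_distrib_left[symmetric] Q_def Z_def D_def E_def k_def C_def)
    qed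
    have mk: "of_nat m = (\<Sum>c\<in>C. of_nat (card c)) + (of_nat k :: rat fps)"
      using card_other_orbits[OF S(1) r a]
      by (simp add: m_def k_def C_def flip: of_nat_sum of_nat_add)
    \<comment> \<open>For a cycle of length \<open>l\<close> the factors combine to
      \<open>(1 - q^(k+l)) - (1 - q^k) * q^l = 1 - q^l\<close>, which is just what completes
      \<open>E c\<close> to \<open>D\<close>.\<close>
    have "Z - (1 - q ^ k) * E1 = (\<Sum>c\<in>C. of_nat (card c) * D)"
      unfolding Z_def E1_def sum_distrib_left sum_subtractf[symmetric]
      by (intro sum.cong refl) (simp add: DE q_def algebra_simps power_add)
    then have H4: "Z - (1 - q ^ k) * E1 = (of_nat m - of_nat k) * D"
      by (simp add: mk sum_distrib_right)
    have H5: "(1 - q) * Q = (1 - q) * (of_nat k - 1) * (1 + q ^ k) - 2 * (q - q ^ k)"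
      using sum_one_minus_power_split[OF k, of "fps_X :: rat fps"] k by (simp add: Q_def q_def of_nat_diff)
    have "(U + q * fps_deriv U + V) * (P * (1 - q) * (1 - q)) = of_nat m * F * (1 - q * q ^ k) * D"
      by (rule cycle_gf_step_identity[OF H1 H2[unfolded of_nat_add of_nat_numeral] H3 H4 H5])
    moreover have "cycle_gf (insert p S) f = U + q * fps_deriv U + V"
      unfolding f_eq cycle_gf_insert_transpose[OF S p r a] by (simp add: U_def V_def q_def)
    moreover have "cycle_weight ?w f (insert p S) = (1 - q * q ^ k) * D"
      unfolding f_eq cycle_weight_insert_transpose[OF S(1) r p a] by (simp add: q_def k_def D_def)
    moreover have "(1 - q) ^ (Suc m + 2) = P * (1 - q) * (1 - q)" by (simp add: P_def mult_ac)
    ultimately show ?thesis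
      by (simp only: card fact_m q_def[symmetric] diff_Suc_1 mult.assoc)
  qed
qed

section \<open>Matchings\<close>

definition matchings :: "'a set \<Rightarrow> ('a \<Rightarrow> 'a) set" where
  "matchings S = {\<alpha>. \<alpha> permutes S \<and> (\<forall>i\<in>S. \<alpha> (\<alpha> i) = i \<and> \<alpha> i \<noteq> i)}"

lemma finite_matchings: "finite S \<Longrightarrow> finite (matchings S)"
  by (rule finite_subset[OF _ finite_permutations]) (auto simp: matchings_def)

lemma matching_involution:
  assumes "\<alpha> \<in> matchings S"
  shows "\<alpha> \<circ> \<alpha> = id"
proof
  fix x show "(\<alpha> \<circ> \<alpha>) x = id x"
    using assms permutes_not_in[of \<alpha> S x] by (cases "x \<in> S") (auto simp: matchings_def)
qed

lemma matching_inv: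
  assumes "\<alpha> \<in> matchings S"
  shows "inv \<alpha> = \<alpha>"
  using matching_involution[OF assms] by (intro inv_unique_comp)

text \<open>A matching is determined by the partner \<open>i\<close> of \<open>p\<close> and the
  matching it induces on the remaining points.\<close>

lemma matchings_remove_pair:
  assumes p: "p \<in> S"
  shows "bij_betw (\<lambda>(i, \<beta>). transpose i p \<circ> \<beta>)
    (SIGMA i:S - {p}. matchings (S - {p, i})) (matchings S)"
  unfolding bij_betw_def
proof
  let ?D = "SIGMA i:S - {p}. matchings (S - {p, i})"
  have fixed: "\<beta> p = p" "\<beta> i = i" if "\<beta> \<in> matchings (S - {p, i})" for i \<beta>
    using that by (auto simp: matchings_def permutes_def)
  show "inj_on (\<lambda>(i, \<beta>). transpose i p \<circ> \<beta>) ?D"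
  proof (rule inj_onI)
    fix x y
    assume "x \<in> ?D" "y \<in> ?D" and "(\<lambda>(i, \<beta>). transpose i p \<circ> \<beta>) x = (\<lambda>(i, \<beta>). transpose i p \<circ> \<beta>) y"
    then obtain i j c d where x: "x = (i, c)" and y: "y = (j, d)"
      and c: "c \<in> matchings (S - {p, i})" and d: "d \<in> matchings (S - {p, j})"
      and eq: "transpose i p \<circ> c = transpose j p \<circ> d" by auto
    have "i = j" using fun_cong[OF eq, of p] fixed(1)[OF c] fixed(1)[OF d] by simp
    moreover have "c = transpose i p \<circ> (transpose i p \<circ> c)" "d = transpose j p \<circ> (transpose j p \<circ> d)"
      by (simp_all add: comp_assoc[symmetric])
    ultimately show "x = y" unfolding x y using eq by metis
  qed
  show "(\<lambda>(i, \<beta>). transpose i p \<circ> \<beta>) ` ?D = matchings S"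
  proof (intro equalityI subsetI)
    fix \<alpha> assume "\<alpha> \<in> (\<lambda>(i, \<beta>). transpose i p \<circ> \<beta>) ` ?D"
    then obtain i \<beta> where i: "i \<in> S" "i \<noteq> p" and \<beta>: "\<beta> \<in> matchings (S - {p, i})"
      and \<alpha>: "\<alpha> = transpose i p \<circ> \<beta>" by auto
    have perm: "\<beta> permutes S - {p, i}" using \<beta> by (simp add: matchings_def)
    have "\<alpha> permutes S"
      unfolding \<alpha> using i p by (intro permutes_compose[OF permutes_subset[OF perm]] permutes_swap_id) auto
    moreover have "\<alpha> (\<alpha> x) = x \<and> \<alpha> x \<noteq> x" if "x \<in> S" for x
    proof (cases "x \<in> {p, i}")
      case True
      then show ?thesis using fixed[OF \<beta>] i by (auto simp: \<alpha>)
    next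
      case False
      then have "x \<in> S - {p, i}" using that by auto
      moreover from this have "\<beta> x \<in> S - {p, i}" using permutes_in_image[OF perm] by blast
      ultimately show ?thesis using \<beta> by (auto simp: \<alpha> matchings_def)
    qed
    ultimately show "\<alpha> \<in> matchings S" by (simp add: matchings_def)
  next
    fix \<alpha> assume \<alpha>: "\<alpha> \<in> matchings S"
    define i \<beta> where "i = \<alpha> p" and "\<beta> = transpose i p \<circ> \<alpha>"
    have inv: "\<alpha> (\<alpha> x) = x" "\<alpha> x \<noteq> x" if "x \<in> S" for x
      using \<alpha> that by (auto simp: matchings_def)
    have perm: "\<alpha> permutes S" using \<alpha> by (simp add: matchings_def)
    have i: "i \<in> S" "i \<noteq> p" using permutes_in_image[OF perm, of p] p inv by (auto simp: i_def)
    have \<alpha>i: "\<alpha> i = p" using inv p by (simp add: i_def)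
    have other: "\<alpha> x \<noteq> p" "\<alpha> x \<noteq> i" if "x \<in> S - {p, i}" for x
      using that inv(1)[of x] \<alpha>i by (auto simp: i_def)
    have "\<beta> permutes S"
      unfolding \<beta>_def using i p by (intro permutes_compose[OF perm] permutes_swap_id) auto
    then have "\<beta> permutes S - {p, i}"
      by (rule permutes_superset) (auto simp: \<beta>_def \<alpha>i i_def[symmetric])
    moreover have "\<beta> x = \<alpha> x" if "x \<in> S - {p, i}" for x
      using other[OF that] by (simp add: \<beta>_def)
    ultimately have "\<beta> \<in> matchings (S - {p, i})"
      using inv other permutes_in_image[OF perm] by (simp add: matchings_def)
    moreover have "\<alpha> = transpose i p \<circ> \<beta>" by (simp add: \<beta>_def comp_assoc[symmetric])
    ultimately show "\<alpha> \<in> (\<lambda>(i, \<beta>). transpose i p \<circ> \<beta>) ` ?D" using i by force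
  qed
qed

text \<open>On \<open>2n + 2\<close> points a given point has \<open>2n + 1\<close> possible
  partners, so the number is a double factorial; the denominators are cleared to stay within the
  natural numbers.\<close>

lemma card_matchings:
  assumes "finite S" "card S = 2 * n"
  shows "card (matchings S) * (2 ^ n * fact n) = fact (2 * n)"
  using assms
proof (induction n arbitrary: S)
  case 0
  then have "matchings S = {id}" by (auto simp: matchings_def)
  then show ?case by simp
next
  case (Suc n)
  then obtain p where p: "p \<in> S" by (metis card.empty ex_in_conv mult_is_0 nat.distinct(1) zero_neq_numeral)
  have card: "card (S - {p}) = 2 * n + 1" using Suc.prems p by simp
  have IH: "card (matchings (S - {p, i})) * (2 ^ n * fact n) = fact (2 * n)" if "i \<in> S - {p}" for i
  proof (rule Suc.IH)
    have "S - {p, i} = S - {p} - {i}" by auto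
    then show "card (S - {p, i}) = 2 * n" using card Suc.prems(1) that by simp
  qed (use Suc.prems in simp)
  have "card (matchings S) = card (SIGMA i:S - {p}. matchings (S - {p, i}))"
    by (rule bij_betw_same_card[OF matchings_remove_pair[OF p], symmetric])
  also have "\<dots> = (\<Sum>i\<in>S - {p}. card (matchings (S - {p, i})))"
    using Suc.prems(1) by (intro card_SigmaI) (auto intro: finite_matchings)
  finally have "card (matchings S) * (2 ^ n * fact n) = (2 * n + 1) * fact (2 * n)"
    by (simp add: sum_distrib_right IH card del: Diff_insert0)
  moreover have "card (matchings S) * (2 ^ Suc n * fact (Suc n)) =
      (2 * n + 2) * (card (matchings S) * (2 ^ n * fact n))"
    by (simp add: algebra_simps)
  ultimately have "card (matchings S) * (2 ^ Suc n * fact (Suc n)) = (2 * n + 2) * ((2 * n + 1) * fact (2 * n))"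
    by simp
  also have "\<dots> = fact (2 * Suc n)" by (simp only: mult_Suc_right fact_Suc add_2_eq_Suc of_nat_id) simp
  finally show ?case .
qed

lemma cycle_weight_matching:
  assumes S: "finite S" "card S = 2 * n" and \<alpha>: "\<alpha> \<in> matchings S"
  shows "cycle_weight g \<alpha> S = g 2 ^ n"
proof -
  have perm: "\<alpha> permutes S" and inv: "\<And>x. x \<in> S \<Longrightarrow> \<alpha> (\<alpha> x) = x \<and> \<alpha> x \<noteq> x"
    using \<alpha> by (auto simp: matchings_def)
  have p: "permutation \<alpha>" by (rule permutes_permutation[OF perm S(1)])
  have card_orbit: "card c = 2" if c: "c \<in> orbit \<alpha> ` S" for c
  proof -
    obtain x where x: "x \<in> S" "c = orbit \<alpha> x" using c by auto
    have "orbit \<alpha> x = {(\<alpha> ^^ m) x | m. m < 2}"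
      using inv[OF x(1)] by (intro orbit_altdef_bounded) (auto simp: numeral_2_eq_2)
    also have "\<dots> = {x, \<alpha> x}"
      by (auto simp: less_Suc_eq numeral_2_eq_2 intro: exI[of _ 0] exI[of _ "Suc 0"])
    finally show ?thesis using inv[OF x(1)] x(2) by auto
  qed
  have "x \<in> orbit \<alpha> x" for x by (rule permutation_self_in_orbit[OF p])
  then have "\<Union> (orbit \<alpha> ` S) = S" using permutes_orbit_subset[OF perm] by blast
  then have "card S = card (\<Union> (orbit \<alpha> ` S))" by simp
  also have "\<dots> = (\<Sum>c\<in>orbit \<alpha> ` S. card c)"
  proof (rule card_Union_disjoint)
    show "disjoint (orbit \<alpha> ` S)"
      unfolding pairwise_def disjnt_def using other_orbits_disjoint[OF p] by blast
    show "finite c" if "c \<in> orbit \<alpha> ` S" for c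
      using card_orbit[OF that] by (metis card.infinite zero_neq_numeral)
  qed
  also have "\<dots> = 2 * card (orbit \<alpha> ` S)" by (simp add: card_orbit)
  finally have "card (orbit \<alpha> ` S) = n" using S by simp
  then show ?thesis by (simp add: cycle_weight_def card_orbit)
qed

section \<open>Averaging over conjugates\<close>

lemma cycle_weight_conjugate:
  assumes S: "finite S" and \<pi>: "\<pi> permutes S" and f: "f permutes S"
  shows "cycle_weight g (\<pi> \<circ> f \<circ> inv \<pi>) S = cycle_weight g f S"
proof -
  have p: "permutation f" by (rule permutes_permutation[OF f S])
  have inj: "inj \<pi>" by (rule permutes_inj[OF \<pi>])
  let ?f = "\<pi> \<circ> f \<circ> inv \<pi>"
  have orb: "orbit ?f (\<pi> x) = \<pi> ` orbit f x" for x
    by (rule orbit_inverse[symmetric, OF permutation_self_in_orbit[OF p]]) (simp add: inv_f_f[OF inj])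
  have "orbit ?f ` S = orbit ?f ` (\<pi> ` S)" by (simp add: permutes_image[OF \<pi>])
  also have "\<dots> = (`) \<pi> ` (orbit f ` S)" by (simp only: image_image orb)
  finally have img: "orbit ?f ` S = (`) \<pi> ` (orbit f ` S)" .
  have "inj_on ((`) \<pi>) (orbit f ` S)" using inj by (simp add: inj_on_def inj_image_eq_iff)
  then show ?thesis
    unfolding cycle_weight_def img
    by (simp add: prod.reindex card_image[OF inj_on_subset[OF inj]])
qed

lemma cycle_weight_inv:
  assumes "finite S" "f permutes S"
  shows "cycle_weight g (inv f) S = cycle_weight g f S"
  using orbit_inv_eq[OF permutes_permutation[OF assms(2,1)]] by (simp add: cycle_weight_def)

lemma matchings_conjugate:
  assumes \<pi>: "\<pi> permutes S" and \<alpha>: "\<alpha> \<in> matchings S"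
  shows "\<pi> \<circ> \<alpha> \<circ> inv \<pi> \<in> matchings S"
proof -
  have inj: "inj \<pi>" by (rule permutes_inj[OF \<pi>])
  have inv_S: "inv \<pi> x \<in> S" if "x \<in> S" for x
    using permutes_in_image[OF permutes_inv[OF \<pi>]] that by simp
  have "\<pi> \<circ> \<alpha> \<circ> inv \<pi> permutes S"
    using \<alpha> \<pi> by (intro permutes_compose permutes_inv) (auto simp: matchings_def)
  moreover have "(\<pi> \<circ> \<alpha> \<circ> inv \<pi>) ((\<pi> \<circ> \<alpha> \<circ> inv \<pi>) x) = x \<and> (\<pi> \<circ> \<alpha> \<circ> inv \<pi>) x \<noteq> x"
    if "x \<in> S" for x
  proof -
    have "\<alpha> (\<alpha> (inv \<pi> x)) = inv \<pi> x" "\<alpha> (inv \<pi> x) \<noteq> inv \<pi> x"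
      using \<alpha> inv_S[OF that] by (simp_all add: matchings_def)
    moreover from this have "\<pi> (\<alpha> (inv \<pi> x)) \<noteq> \<pi> (inv \<pi> x)" using inj by (simp add: inj_eq)
    ultimately show ?thesis by (simp add: inv_f_f[OF inj] permutes_inverses(1)[OF \<pi>])
  qed
  ultimately show ?thesis by (simp add: matchings_def)
qed

text \<open>As \<alpha> is its own inverse, \<open>\<alpha> \<circ> c\<close> is the vertex
  permutation of the map with boundary \<open>c\<close>. For nonempty \<open>S\<close> the summand
  is \<open>N\<close> to the number of vertices.\<close>

definition vertex_sum :: "'b::comm_semiring_1 \<Rightarrow> 'a set \<Rightarrow> ('a \<Rightarrow> 'a) \<Rightarrow> 'b" where
  "vertex_sum N S c = (\<Sum>\<alpha>\<in>matchings S. cycle_weight (\<lambda>_. N) (\<alpha> \<circ> c) S)"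

text \<open>If \<pi> conjugates \<open>c\<close> to \<open>d\<close>, conjugation by its inverse
  permutes the matchings and turns the vertex permutation for \<open>d\<close> into a conjugate one
  for \<open>c\<close>, with equally many cycles.\<close>

lemma vertex_sum_full_cycle:
  assumes S: "finite S" and c: "c \<in> full_cycles S" and d: "d \<in> full_cycles S"
  shows "vertex_sum N S d = vertex_sum N S c"
proof -
  obtain \<pi> where \<pi>: "\<pi> permutes S" and d_eq: "d = \<pi> \<circ> c \<circ> inv \<pi>"
    using full_cycles_conjugate[OF c d] by blast
  have inv_\<pi>: "inv \<pi> permutes S" and inv_inv: "inv (inv \<pi>) = \<pi>"
    using permutes_inv[OF \<pi>] permutes_inv_inv[OF \<pi>] by auto
  have id: "inv \<pi> \<circ> \<pi> = id" "\<pi> \<circ> inv \<pi> = id" using permutes_inv_o[OF \<pi>] by auto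
  have cancel: "inv \<pi> \<circ> (\<pi> \<circ> h) = h" "\<pi> \<circ> (inv \<pi> \<circ> h) = h" for h
    by (simp_all add: comp_assoc[symmetric] id)
  show ?thesis
    unfolding vertex_sum_def
  proof (rule sum.reindex_bij_witness[of _ "\<lambda>\<alpha>. \<pi> \<circ> \<alpha> \<circ> inv \<pi>" "\<lambda>\<alpha>. inv \<pi> \<circ> \<alpha> \<circ> \<pi>"])
    fix \<alpha> assume \<alpha>: "\<alpha> \<in> matchings S"
    show "inv \<pi> \<circ> \<alpha> \<circ> \<pi> \<in> matchings S"
      using matchings_conjugate[OF inv_\<pi> \<alpha>] by (simp add: inv_inv)
    have "inv \<pi> \<circ> \<alpha> \<circ> \<pi> \<circ> c permutes S"
      using \<alpha> \<pi> inv_\<pi> full_cycles_permutes[OF c]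
      by (intro permutes_compose) (auto simp: matchings_def)
    moreover have "\<alpha> \<circ> d = \<pi> \<circ> (inv \<pi> \<circ> \<alpha> \<circ> \<pi> \<circ> c) \<circ> inv \<pi>"
      by (simp only: d_eq comp_assoc cancel)
    ultimately show "cycle_weight (\<lambda>_. N) (inv \<pi> \<circ> \<alpha> \<circ> \<pi> \<circ> c) S = cycle_weight (\<lambda>_. N) (\<alpha> \<circ> d) S"
      using cycle_weight_conjugate[OF S \<pi>] by metis
  next
    fix \<alpha> assume "\<alpha> \<in> matchings S"
    then show "\<pi> \<circ> \<alpha> \<circ> inv \<pi> \<in> matchings S" by (rule matchings_conjugate[OF \<pi>])
  qed (simp_all add: comp_assoc cancel id)
qed

lemma card_full_cycles:
  assumes "finite S" "S \<noteq> {}"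
  shows "card (full_cycles S) = fact (card S - 1)"
  using assms
proof (induction rule: finite_ne_induct)
  case (insert p S)
  have "card S > 0" using insert.hyps by (simp add: card_gt_0_iff)
  then show ?case
    using bij_betw_same_card[OF full_cycles_insert[OF insert.hyps(3,2)]] insert
    by (simp add: card_cartesian_product fact_reduce[of "card S"])
qed (simp add: full_cycles_singleton)

text \<open>Double counting of pairs of a matching and a full cycle. As
  \<open>inv d \<circ> \<alpha>\<close> is the inverse of \<open>\<alpha> \<circ> d\<close>, both
  have the same cycles; after exchanging the sums every full cycle \<open>d\<close> contributes as
  much as \<open>c\<close>.\<close>

lemma sum_cycle_sum_matchings:
  assumes S: "finite S" "S \<noteq> {}" and c: "c \<in> full_cycles S"
  shows "(\<Sum>\<alpha>\<in>matchings S. cycle_sum N S \<alpha>) = of_nat (fact (card S - 1)) * vertex_sum N S c"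
proof -
  have "(\<Sum>\<alpha>\<in>matchings S. cycle_sum N S \<alpha>) =
      (\<Sum>d\<in>full_cycles S. \<Sum>\<alpha>\<in>matchings S. cycle_weight (\<lambda>_. N) (inv d \<circ> \<alpha>) S)"
    unfolding cycle_sum_def by (rule sum.swap)
  also have "\<dots> = (\<Sum>d\<in>full_cycles S. vertex_sum N S d)"
    unfolding vertex_sum_def
  proof (intro sum.cong refl)
    fix d \<alpha> assume d: "d \<in> full_cycles S" and \<alpha>: "\<alpha> \<in> matchings S"
    have \<alpha>S: "\<alpha> permutes S" using \<alpha> by (simp add: matchings_def)
    note dS = full_cycles_permutes[OF d]
    have "inv (\<alpha> \<circ> d) = inv d \<circ> \<alpha>"
      using o_inv_distrib[OF permutes_bij[OF \<alpha>S] permutes_bij[OF dS]] matching_inv[OF \<alpha>] by simp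
    then show "cycle_weight (\<lambda>_. N) (inv d \<circ> \<alpha>) S = cycle_weight (\<lambda>_. N) (\<alpha> \<circ> d) S"
      using cycle_weight_inv[OF S(1) permutes_compose[OF dS \<alpha>S]] by metis
  qed
  also have "\<dots> = (\<Sum>d\<in>full_cycles S. vertex_sum N S c)"
    by (intro sum.cong refl vertex_sum_full_cycle[OF S(1) c])
  finally show ?thesis by (simp add: card_full_cycles[OF S])
qed

text \<open>All cycles of a matching have length 2, so Zagier's product is
  \<open>((1 + X) (1 - X))^n\<close> for each of them. Against the denominator
  \<open>(1 - X)^(2n+2)\<close> a factor \<open>(1 - X)^n\<close> cancels, and so does the number of
  full cycles.\<close>

lemma vertex_sum_gf:
  assumes S: "finite S" "card S = 2 * n" "S \<noteq> {}" and c: "c \<in> full_cycles S"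
  shows "Abs_fps (\<lambda>N. vertex_sum (of_nat (Suc N)) S c :: rat) * (1 - fps_X) ^ (n + 2) =
    of_nat (card (matchings S)) * (1 + fps_X) ^ n"
proof -
  define V where "V = Abs_fps (\<lambda>N. vertex_sum (of_nat (Suc N)) S c :: rat)"
  define F where "F = (of_nat (fact (card S - 1)) :: rat fps)"
  have F: "F \<noteq> 0" unfolding F_def of_nat_eq_0_iff by simp
  have "F * V = (\<Sum>\<alpha>\<in>matchings S. cycle_gf S \<alpha>)"
    by (rule fps_ext)
      (simp add: F_def V_def cycle_gf_def fps_sum_nth sum_cycle_sum_matchings[OF S(1,3) c] del: of_nat_fact of_nat_Suc)
  then have "F * V * (1 - fps_X) ^ (card S + 2) =
      (\<Sum>\<alpha>\<in>matchings S. F * cycle_weight (\<lambda>k. 1 - fps_X ^ k) \<alpha> S)"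
    unfolding sum_distrib_right
    by (auto simp only: sum_distrib_right matchings_def F_def of_nat_fact intro!: sum.cong cycle_gf_eq[OF S(1,3)])
  also have "\<dots> = (\<Sum>\<alpha>\<in>matchings S. F * (1 - fps_X\<^sup>2) ^ n)"
    by (intro sum.cong refl) (simp add: cycle_weight_matching[OF S(1,2)])
  also have "\<dots> = F * (of_nat (card (matchings S)) * (1 - fps_X\<^sup>2) ^ n)" by simp
  also have "(1 - fps_X\<^sup>2 :: rat fps) = (1 + fps_X) * (1 - fps_X)"
    by (simp add: power2_eq_square algebra_simps)
  finally have "F * V * (1 - fps_X) ^ (n + (n + 2)) =
      F * (of_nat (card (matchings S)) * ((1 + fps_X) * (1 - fps_X)) ^ n)"
    by (simp only: S(2) mult_2 add.assoc)
  then have "(F * (1 - fps_X) ^ n) * (V * (1 - fps_X) ^ (n + 2)) =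
      (F * (1 - fps_X) ^ n) * (of_nat (card (matchings S)) * (1 + fps_X) ^ n)"
    by (simp only: power_mult_distrib power_add mult_ac)
  moreover have "F * (1 - fps_X) ^ n \<noteq> 0" using F by simp
  ultimately show ?thesis unfolding V_def using mult_left_cancel by blast
qed

text \<open>Multiplying by \<open>1 - X\<close> takes differences of consecutive coefficients, which
  lowers \<open>k\<close> by one through Pascal's rule.\<close>

lemma fps_binomial_diagonal:
  "Abs_fps (\<lambda>j. of_nat ((j + k) choose k) :: 'b::comm_ring_1) * (1 - fps_X) ^ Suc k = 1"
proof (induction k)
  case 0
  show ?case by (rule fps_ext) (simp add: algebra_simps)
next
  case (Suc k)
  have "Abs_fps (\<lambda>j. of_nat ((j + Suc k) choose Suc k) :: 'b) * (1 - fps_X) =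
      Abs_fps (\<lambda>j. of_nat ((j + k) choose k))"
  proof (rule fps_ext)
    fix j
    show "fps_nth (Abs_fps (\<lambda>j. of_nat ((j + Suc k) choose Suc k) :: 'b) * (1 - fps_X)) j =
        fps_nth (Abs_fps (\<lambda>j. of_nat ((j + k) choose k))) j"
      by (cases j) (simp_all add: algebra_simps binomial_eq_0)
  qed
  then show ?case using Suc.IH by (simp add: mult.assoc[symmetric])
qed

lemma vertex_sum_eq:
  assumes S: "finite S" "card S = 2 * n" "S \<noteq> {}" and c: "c \<in> full_cycles S"
  shows "vertex_sum (of_nat (Suc N)) S c =
    (of_nat (card (matchings S)) * (\<Sum>k\<le>N. of_nat (n choose k) * of_nat ((N - k + (n + 1)) choose (n + 1))) :: rat)"
proof -
  define V where "V = Abs_fps (\<lambda>N. vertex_sum (of_nat (Suc N)) S c :: rat)"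
  define B where "B = Abs_fps (\<lambda>j. of_nat ((j + (n + 1)) choose (n + 1)) :: rat)"
  have B: "(1 - fps_X) ^ (n + 2) * B = 1"
    using fps_binomial_diagonal[of "n + 1", where 'b = rat] by (simp add: B_def mult.commute)
  have "V = V * (1 - fps_X) ^ (n + 2) * B" by (simp only: mult.assoc B mult_1_right)
  also have "\<dots> = of_nat (card (matchings S)) * ((1 + fps_X) ^ n * B)"
    using vertex_sum_gf[OF S c] by (simp only: V_def mult.assoc)
  also have "(1 + fps_X :: rat fps) ^ n = Abs_fps (\<lambda>k. of_nat (n choose k))"
    unfolding fps_binomial_of_nat[symmetric] by (rule fps_ext) (simp add: binomial_gbinomial)
  finally have "fps_nth V N =
      of_nat (card (matchings S)) * fps_nth (Abs_fps (\<lambda>k. of_nat (n choose k)) * B) N"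
    by simp
  then show ?thesis
    by (simp add: V_def B_def fps_mult_nth atLeast0AtMost del: of_nat_Suc binomial_Suc_Suc)
qed

section \<open>One-face maps\<close>

text \<open>The sum over \<open>k\<close> on the right-hand side of the theorem, cut off at
  \<open>n\<close> where the binomial coefficients vanish.\<close>

definition vertex_poly :: "nat \<Rightarrow> rat poly" where
  "vertex_poly n = (\<Sum>k\<le>n. smult (of_nat (n choose k))
     (poly_binomial [:of_nat n - of_nat k, 1:] (n + 1)))"

lemma poly_poly_binomial: "poly (poly_binomial p m) x = poly p x gchoose m"
  by (simp add: poly_binomial_def gbinomial_prod_rev poly_prod lessThan_atLeast0)

lemma poly_vertex_poly:
  "poly (vertex_poly n) x = (\<Sum>k\<le>n. of_nat (n choose k) * ((x + of_nat n - of_nat k) gchoose (n + 1)))"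
  by (simp add: vertex_poly_def poly_sum poly_poly_binomial algebra_simps)

text \<open>At \<open>x = N + 1\<close> this is the coefficient of index \<open>N\<close> found in
  \<open>vertex_sum_eq\<close>. The bounds \<open>n\<close> and \<open>N\<close> may be exchanged:
  for \<open>k > N\<close> the second binomial coefficient vanishes, for \<open>k > n\<close> the
  first.\<close>

lemma poly_vertex_poly_Suc:
  "poly (vertex_poly n) (of_nat (Suc N)) =
    (\<Sum>k\<le>N. of_nat (n choose k) * of_nat ((N - k + (n + 1)) choose (n + 1)))"
proof -
  have "poly (vertex_poly n) (of_nat (Suc N)) =
      (\<Sum>k\<le>n. of_nat (n choose k) * of_nat ((Suc N + n - k) choose (n + 1)))"
    unfolding poly_vertex_poly
  proof (intro sum.cong refl)
    fix k assume "k \<in> {..n}"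
    then have "of_nat (Suc N) + of_nat n - of_nat k = (of_nat (Suc N + n - k) :: rat)"
      by (simp add: of_nat_diff)
    then show "of_nat (n choose k) * ((of_nat (Suc N) + of_nat n - of_nat k) gchoose (n + 1)) =
        (of_nat (n choose k) * of_nat ((Suc N + n - k) choose (n + 1)) :: rat)"
      by (simp only: binomial_gbinomial)
  qed
  also have "\<dots> = (\<Sum>k\<in>{..n} \<inter> {..N}. of_nat (n choose k) * of_nat ((Suc N + n - k) choose (n + 1)))"
    by (rule sum.mono_neutral_right) (auto simp: binomial_eq_0)
  also have "\<dots> = (\<Sum>k\<le>N. of_nat (n choose k) * of_nat ((Suc N + n - k) choose (n + 1)))"
    by (rule sum.mono_neutral_left) (auto simp: binomial_eq_0)
  also have "\<dots> = (\<Sum>k\<le>N. of_nat (n choose k) * of_nat ((N - k + (n + 1)) choose (n + 1)))"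
    by (intro sum.cong refl) (simp add: Suc_diff_le)
  finally show ?thesis .
qed

text \<open>Replace \<open>k\<close> by \<open>n - k\<close> and apply upper negation, which turns
  \<open>y\<close> choose \<open>n + 1\<close> into \<open>(-1)^(n+1)\<close> times
  \<open>n - y\<close> choose \<open>n + 1\<close>.\<close>

lemma poly_vertex_poly_minus:
  "poly (vertex_poly n) (- x) = (- 1) ^ (n + 1) * poly (vertex_poly n) x"
proof -
  have "poly (vertex_poly n) (- x) =
      (\<Sum>k\<le>n. of_nat (n choose (n - k)) * ((- x + of_nat n - of_nat (n - k)) gchoose (n + 1)))"
    unfolding poly_vertex_poly
    by (rule sum.reindex_bij_witness[of _ "\<lambda>k. n - k" "\<lambda>k. n - k"]) auto
  also have "\<dots> = (\<Sum>k\<le>n. (- 1) ^ (n + 1) * (of_nat (n choose k) * ((x + of_nat n - of_nat k) gchoose (n + 1))))"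
  proof (intro sum.cong refl)
    fix k assume k: "k \<in> {..n}"
    have arg: "of_nat (n + 1) - (- x + of_nat n - of_nat (n - k)) - 1 = x + of_nat n - of_nat k"
      using k by (simp add: of_nat_diff)
    show "of_nat (n choose (n - k)) * ((- x + of_nat n - of_nat (n - k)) gchoose (n + 1)) =
        (- 1) ^ (n + 1) * (of_nat (n choose k) * ((x + of_nat n - of_nat k) gchoose (n + 1)))"
      using k unfolding gbinomial_negated_upper[of "- x + of_nat n - of_nat (n - k)"] arg
      by (simp add: binomial_symmetric[symmetric])
  qed
  finally show ?thesis by (simp add: poly_vertex_poly sum_distrib_left)
qed

lemma poly_eq_infinite:
  fixes p q :: "'b::idom poly"
  assumes "infinite {x. poly p x = poly q x}"
  shows "p = q"
proof (rule ccontr)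
  assume "p \<noteq> q"
  then have "finite {x. poly (p - q) x = 0}" by (intro poly_roots_finite) simp
  then show False using assms by simp
qed

text \<open>The bound is that of the degree. For the parity, substituting \<open>-x\<close>
  multiplies the coefficient of index \<open>i\<close> by \<open>(-1)^i\<close>, but by the previous
  symmetry also by \<open>(-1)^(n+1)\<close>.\<close>

lemma coeff_vertex_poly_nonzero:
  assumes "coeff (vertex_poly n) i \<noteq> 0"
  shows "i \<le> n + 1" "even (n + 1 - i)"
proof -
  have "degree (poly_binomial [:of_nat n - of_nat k, 1 :: rat:] (n + 1)) \<le> n + 1" for k
    unfolding poly_binomial_def
    by (rule order.trans[OF degree_smult_le order.trans[OF degree_prod_sum_le]])
      (auto intro!: order.trans[OF sum_bounded_above[of _ _ 1]] simp: of_nat_poly)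
  then have "degree (vertex_poly n) \<le> n + 1"
    unfolding vertex_poly_def
    by (intro degree_sum_le) (auto intro: order.trans[OF degree_smult_le])
  then show i: "i \<le> n + 1" using le_degree[OF assms] by linarith
  have "pcompose (vertex_poly n) [:0, - 1:] = smult ((- 1) ^ (n + 1)) (vertex_poly n)"
    by (rule poly_eq_poly_eq_iff[THEN iffD1])
      (auto simp: fun_eq_iff poly_pcompose poly_vertex_poly_minus)
  then have "coeff (pcompose (vertex_poly n) [:0, - 1:]) i = (- 1) ^ (n + 1) * coeff (vertex_poly n) i"
    by simp
  then have "(- 1) ^ i * coeff (vertex_poly n) i = (- 1) ^ (n + 1) * coeff (vertex_poly n) i"
    by (simp only: coeff_pcompose_linear)
  then have "(- 1) ^ i = ((- 1) ^ (n + 1) :: rat)"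
    using mult_right_cancel[OF assms] by blast
  then have "even i \<longleftrightarrow> even (n + 1)" by (auto simp: minus_one_power_iff split: if_splits)
  then show "even (n + 1 - i)" using i by simp
qed

section \<open>Maps as matchings, and their vertex numbers\<close>

lemma long_cycle_full_cycle: "long_cycle n \<in> full_cycles {1..2 * n}"
  unfolding full_cycles_def long_cycle_def by (auto intro!: exI[of _ "[1..<2 * n + 1]"])

text \<open>As \<alpha> is an involution, \<open>\<gamma> = \<alpha> \<circ> \<beta>\<close> can be
  solved for \<beta>, so a map is given by its matching alone.\<close>

lemma one_face_maps_iff:
  "(\<alpha>, \<beta>, \<gamma>) \<in> one_face_maps n \<longleftrightarrow>
    \<alpha> \<in> matchings {1..2 * n} \<and> \<beta> = \<alpha> \<circ> long_cycle n \<and> \<gamma> = long_cycle n"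
proof (cases "\<alpha> \<in> matchings {1..2 * n}")
  case True
  then have \<alpha>: "\<alpha> permutes {1..2 * n}" by (simp add: matchings_def)
  have cancel: "\<alpha> \<circ> (\<alpha> \<circ> h) = h" for h
    using matching_involution[OF True] by (simp add: comp_assoc[symmetric])
  have perm: "\<alpha> \<circ> long_cycle n permutes {1..2 * n}"
    by (rule permutes_compose[OF full_cycles_permutes[OF long_cycle_full_cycle] \<alpha>])
  have "(\<alpha>, \<beta>, \<gamma>) \<in> one_face_maps n \<longleftrightarrow>
      \<beta> permutes {1..2 * n} \<and> \<gamma> = long_cycle n \<and> long_cycle n = \<alpha> \<circ> \<beta>"
    using True by (auto simp: one_face_maps_def matchings_def)
  also have "\<dots> \<longleftrightarrow> \<beta> = \<alpha> \<circ> long_cycle n \<and> \<gamma> = long_cycle n"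
    using perm cancel by metis
  finally show ?thesis using True by simp
qed (auto simp: one_face_maps_def matchings_def)

lemma bij_betw_matchings_one_face_maps:
  "bij_betw (\<lambda>\<alpha>. (\<alpha>, \<alpha> \<circ> long_cycle n, long_cycle n)) (matchings {1..2 * n}) (one_face_maps n)"
  by (auto simp: bij_betw_def inj_on_def one_face_maps_iff image_iff)

lemma finite_one_face_maps: "finite (one_face_maps n)"
  using bij_betw_finite[OF bij_betw_matchings_one_face_maps] finite_matchings by blast

text \<open>For \<open>n > 0\<close> both polynomials agree at every positive integer, where the
  left one takes the value of \<open>vertex_sum\<close> at the long cycle.\<close>

lemma sum_num_vertices:
  "(\<Sum>(\<alpha>, \<beta>, \<gamma>)\<in>one_face_maps n. monom 1 (num_vertices n \<beta>)) =
    smult (of_nat (card (matchings {1..2 * n}))) (vertex_poly n)"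
proof -
  let ?S = "{1..2 * n}"
  have sum: "(\<Sum>(\<alpha>, \<beta>, \<gamma>)\<in>one_face_maps n. monom 1 (num_vertices n \<beta>)) =
      (\<Sum>\<alpha>\<in>matchings ?S. monom 1 (num_vertices n (\<alpha> \<circ> long_cycle n)) :: rat poly)"
    by (subst sum.reindex_bij_betw[OF bij_betw_matchings_one_face_maps, symmetric]) simp
  show ?thesis
  proof (cases "n = 0")
    \<comment> \<open>Without labels there are no orbits to count; the single vertex comes from the
      definition of \<open>num_vertices\<close>, and both sides are the monomial
      \<open>x\<close>.\<close>
    case True
    have "matchings {} = {id :: nat \<Rightarrow> nat}" by (auto simp: matchings_def)
    then show ?thesis
      unfolding sum by (simp add: True num_vertices_def vertex_poly_def poly_binomial_def monom_altdef)
  next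
    case False
    show ?thesis
      unfolding sum
    proof (rule poly_eq_infinite)
      have "poly (\<Sum>\<alpha>\<in>matchings ?S. monom 1 (num_vertices n (\<alpha> \<circ> long_cycle n))) (of_nat (Suc N)) =
          poly (smult (of_nat (card (matchings ?S))) (vertex_poly n)) (of_nat (Suc N) :: rat)" for N
      proof -
        have "poly (\<Sum>\<alpha>\<in>matchings ?S. monom 1 (num_vertices n (\<alpha> \<circ> long_cycle n))) (of_nat (Suc N)) =
            (vertex_sum (of_nat (Suc N)) ?S (long_cycle n) :: rat)"
          using False by (simp add: vertex_sum_def cycle_weight_def poly_sum poly_monom num_vertices_def del: of_nat_Suc)
        also have "\<dots> = poly (smult (of_nat (card (matchings ?S))) (vertex_poly n)) (of_nat (Suc N))"
          using vertex_sum_eq[OF _ _ _ long_cycle_full_cycle, of n n N] False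
          by (simp only: poly_smult poly_vertex_poly_Suc) simp
        finally show ?thesis .
      qed
      then have "range (\<lambda>N. of_nat (Suc N)) \<subseteq> {x. poly (\<Sum>\<alpha>\<in>matchings ?S. monom 1 (num_vertices n (\<alpha> \<circ> long_cycle n))) x =
          poly (smult (of_nat (card (matchings ?S))) (vertex_poly n)) (x :: rat)}" by blast
      moreover have "infinite (range (\<lambda>N. of_nat (Suc N) :: rat))"
        by (rule range_inj_infinite) (simp add: inj_on_def)
      ultimately show "infinite {x. poly (\<Sum>\<alpha>\<in>matchings ?S. monom 1 (num_vertices n (\<alpha> \<circ> long_cycle n))) x =
          poly (smult (of_nat (card (matchings ?S))) (vertex_poly n)) (x :: rat)}"
        using finite_subset by blast
    qed
  qed
qed

text \<open>Every map has a genus: a vertex number occurring in the sum above has a nonzero coefficient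
  in \<open>vertex_poly n\<close>, because the monomials on the left cannot cancel.\<close>

lemma num_vertices_genus:
  assumes "(\<alpha>, \<beta>, \<gamma>) \<in> one_face_maps n"
  shows "num_vertices n \<beta> \<le> n + 1" "even (n + 1 - num_vertices n \<beta>)"
proof -
  let ?v = "\<lambda>(\<alpha>, \<beta>, \<gamma>). num_vertices n \<beta>"
  let ?i = "num_vertices n \<beta>"
  have "coeff (\<Sum>(\<alpha>, \<beta>, \<gamma>)\<in>one_face_maps n. monom (1::rat) (num_vertices n \<beta>)) ?i =
      (\<Sum>t\<in>one_face_maps n. if ?v t = ?i then 1 else 0)"
    by (simp add: coeff_sum case_prod_unfold)
  also have "\<dots> = of_nat (card {t \<in> one_face_maps n. ?v t = ?i})"
    by (simp add: sum.If_cases[OF finite_one_face_maps] Int_def)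
  also have "\<dots> \<noteq> 0"
    using assms finite_one_face_maps[of n] by (auto simp: card_eq_0_iff)
  finally have "coeff (vertex_poly n) ?i \<noteq> 0"
    unfolding sum_num_vertices by auto
  then show "?i \<le> n + 1" "even (n + 1 - ?i)"
    by (fact coeff_vertex_poly_nonzero)+
qed

text \<open>A permutation commuting with the long cycle commutes with its powers, and these carry
  the label 1 to every other label; so it is determined by its value at 1.\<close>

lemma commutes_with_long_cycle:
  assumes \<pi>: "\<pi> permutes {1..2 * n}" "\<pi> 1 = 1"
    and eq: "long_cycle n = \<pi> \<circ> long_cycle n \<circ> inv \<pi>"
  shows "\<pi> = id"
proof
  have bij: "bij \<pi>" by (rule permutes_bij[OF \<pi>(1)])
  have comm: "long_cycle n (\<pi> x) = \<pi> (long_cycle n x)" for x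
    using fun_cong[OF eq, of "\<pi> x"] by (simp add: inv_f_f[OF bij_is_inj[OF bij]])
  have power: "(long_cycle n ^^ k) (\<pi> x) = \<pi> ((long_cycle n ^^ k) x)" for k x
    by (induction k) (simp_all add: comm)
  fix x show "\<pi> x = id x"
  proof (cases "x \<in> {1..2 * n}")
    case True
    then have "n > 0" by auto
    let ?xs = "[1..<2 * n + 1]"
    \<comment> \<open>The list starts with 1, so the label \<open>x\<close> is reached from it after
      \<open>x - 1\<close> rotations.\<close>
    have "(long_cycle n ^^ (x - 1)) (?xs ! 0) = map (long_cycle n ^^ (x - 1)) ?xs ! 0"
      using \<open>n > 0\<close> by (intro nth_map[symmetric]) simp
    also have "map (long_cycle n ^^ (x - 1)) ?xs = rotate (x - 1) ?xs"
      unfolding long_cycle_def by (rule cyclic_rotation) simp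
    also have "rotate (x - 1) ?xs ! 0 = x" using True by (subst nth_rotate) (auto simp del: upt_Suc)
    finally have "(long_cycle n ^^ (x - 1)) 1 = x" using \<open>n > 0\<close> by (simp del: upt_Suc)
    then show ?thesis using power[of "x - 1" 1] \<pi>(2) by simp
  next
    case False
    then show ?thesis using permutes_not_in[OF \<pi>(1)] by simp
  qed
qed

text \<open>A relabelling that fixes the root and the common boundary is the identity, so every
  equivalence class is a singleton.\<close>

lemma A_eq_card: "A n g = card (one_face_maps_of_genus n g)"
proof -
  have "rooted_equiv n `` {t} = {t}" if "t \<in> one_face_maps n" for t
  proof -
    obtain \<alpha> \<beta> \<gamma> where t: "t = (\<alpha>, \<beta>, \<gamma>)" by (cases t) auto
    have \<gamma>: "\<gamma> = long_cycle n" using that by (simp add: t one_face_maps_iff)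
    show ?thesis
    proof (intro equalityI subsetI)
      fix s assume "s \<in> rooted_equiv n `` {t}"
      then obtain \<alpha>' \<beta>' \<gamma>' \<pi> where s: "s = (\<alpha>', \<beta>', \<gamma>')" "s \<in> one_face_maps n"
        and \<pi>: "\<pi> permutes {1..2 * n}" "\<pi> 1 = 1"
        and eq: "\<alpha>' = \<pi> \<circ> \<alpha> \<circ> inv \<pi>" "\<gamma>' = \<pi> \<circ> \<gamma> \<circ> inv \<pi>"
        by (auto simp: rooted_equiv_def t)
      have \<gamma>': "\<gamma>' = long_cycle n" using s by (simp add: one_face_maps_iff)
      have "\<pi> = id" using commutes_with_long_cycle[OF \<pi>] eq(2) \<gamma>' \<gamma> by simp
      then have "\<alpha>' = \<alpha>" using eq(1) by (simp add: inv_id)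
      then show "s \<in> {t}" using s that by (simp add: t one_face_maps_iff)
    next
      fix s assume "s \<in> {t}"
      then show "s \<in> rooted_equiv n `` {t}"
        using that by (auto simp: rooted_equiv_def t intro!: exI[of _ id] permutes_id)
    qed
  qed
  moreover have "one_face_maps_of_genus n g \<subseteq> one_face_maps n"
    by (auto simp: one_face_maps_of_genus_def)
  ultimately have "rooted_equiv n `` {t} = {t}" if "t \<in> one_face_maps_of_genus n g" for t
    using that by blast
  then have "one_face_maps_of_genus n g // rooted_equiv n = (\<lambda>t. {t}) ` one_face_maps_of_genus n g"
    unfolding quotient_def by simp blast
  then show ?thesis
    by (simp add: A_def card_image)
qed

theorem theorem2p3:
  fixes n :: nat
  shows "Sum_any (\<lambda>g. monom (of_nat (A n g)) (n + 1 - 2 * g) :: rat poly) =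
    smult (fact (2 * n) / (2 ^ n * fact n))
      (Sum_any (\<lambda>k. smult (of_nat (n choose k))
         (poly_binomial [:of_nat n - of_nat k, 1:] (n + 1))))"
proof -
  let ?F = "one_face_maps_of_genus n"
  \<comment> \<open>The number of vertices is nonnegative, which forces
    \<open>2 * g \<le> n + 1\<close>. So the truncated difference \<open>n + 1 - 2 * g\<close> is
    the true one.\<close>
  have num: "int (num_vertices n \<beta>) = int n + 1 - 2 * int g" "g \<le> n" "num_vertices n \<beta> = n + 1 - 2 * g"
    if "(\<alpha>, \<beta>, \<gamma>) \<in> ?F g" for \<alpha> \<beta> \<gamma> g
  proof -
    show *: "int (num_vertices n \<beta>) = int n + 1 - 2 * int g"
      using that by (auto simp: one_face_maps_of_genus_def)
    then show "g \<le> n" "num_vertices n \<beta> = n + 1 - 2 * g" by (cases n; simp; linarith)+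
  qed
  have fin: "finite (?F g)" for g
    by (rule finite_subset[OF _ finite_one_face_maps]) (auto simp: one_face_maps_of_genus_def)
  \<comment> \<open>For \<open>g > n\<close> the exponent \<open>n + 1 - 2 * g\<close> truncates to
    0; the vanishing of \<open>A n g\<close> keeps these terms from adding to the constant
    coefficient.\<close>
  have A_0: "A n g = 0" if "g > n" for g
  proof -
    have "t \<notin> ?F g" for t using num(2)[of _ _ _ g] that by (cases t) fastforce
    then have "?F g = {}" by blast
    then show ?thesis by (simp add: A_eq_card)
  qed
  have "g \<le> n" if "monom (of_nat (A n g)) (n + 1 - 2 * g) \<noteq> (0 :: rat poly)" for g
    using that A_0 by (cases "g \<le> n") simp_all
  then have "Sum_any (\<lambda>g. monom (of_nat (A n g)) (n + 1 - 2 * g) :: rat poly) =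
      (\<Sum>g\<le>n. monom (of_nat (A n g)) (n + 1 - 2 * g))"
    by (intro Sum_any.expand_superset) auto
  also have "\<dots> = (\<Sum>g\<le>n. \<Sum>(\<alpha>, \<beta>, \<gamma>)\<in>?F g. monom 1 (num_vertices n \<beta>))"
  proof (intro sum.cong refl)
    fix g
    have "(\<Sum>(\<alpha>, \<beta>, \<gamma>)\<in>?F g. monom 1 (num_vertices n \<beta>)) = (\<Sum>t\<in>?F g. monom (1::rat) (n + 1 - 2 * g))"
      by (intro sum.cong refl) (auto simp: num(3))
    then show "monom (of_nat (A n g)) (n + 1 - 2 * g) =
        (\<Sum>(\<alpha>, \<beta>, \<gamma>)\<in>?F g. monom (1::rat) (num_vertices n \<beta>))"
      by (simp add: A_eq_card of_nat_poly smult_monom)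
  qed
  also have "\<dots> = (\<Sum>(\<alpha>, \<beta>, \<gamma>)\<in>(\<Union>g\<le>n. ?F g). monom 1 (num_vertices n \<beta>))"
    using fin by (intro sum.UNION_disjoint[symmetric]) (auto dest!: num(1))
  \<comment> \<open>The sets of maps of fixed genus exhaust all maps: by
    \<open>num_vertices_genus\<close> the defect \<open>n + 1 - num_vertices n \<beta>\<close> is
    even, and half of it is the genus.\<close>
  also have "(\<Union>g\<le>n. ?F g) = one_face_maps n"
  proof (intro equalityI subsetI)
    fix t assume t: "t \<in> one_face_maps n"
    obtain \<alpha> \<beta> \<gamma> where t_eq: "t = (\<alpha>, \<beta>, \<gamma>)" by (cases t) auto
    note v = num_vertices_genus[OF t[unfolded t_eq]]
    obtain g where g: "n + 1 - num_vertices n \<beta> = 2 * g" using v(2) by (rule evenE)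
    have "t \<in> ?F g" using t g v(1) by (auto simp: t_eq one_face_maps_of_genus_def)
    moreover from this have "g \<le> n" using num(2) t_eq by blast
    ultimately show "t \<in> (\<Union>g\<le>n. ?F g)" by blast
  qed (auto simp: one_face_maps_of_genus_def)
  also have "(\<Sum>(\<alpha>, \<beta>, \<gamma>)\<in>one_face_maps n. monom 1 (num_vertices n \<beta>)) =
      smult (of_nat (card (matchings {1..2 * n}))) (vertex_poly n)"
    by (rule sum_num_vertices)
  also have "of_nat (card (matchings {1..2 * n})) = (fact (2 * n) / (2 ^ n * fact n) :: rat)"
  proof -
    have "of_nat (card (matchings {1..2 * n}) * (2 ^ n * fact n)) = (of_nat (fact (2 * n)) :: rat)"
      by (subst card_matchings) simp_all
    then show ?thesis by (simp add: field_simps)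
  qed
  also have "vertex_poly n = Sum_any (\<lambda>k. smult (of_nat (n choose k))
      (poly_binomial [:of_nat n - of_nat k, 1:] (n + 1)))"
    unfolding vertex_poly_def
  proof (rule Sum_any.expand_superset[symmetric])
    have "k \<le> n" if "smult (of_nat (n choose k)) p \<noteq> 0" for k and p :: "rat poly"
      using that by (cases "k \<le> n") (simp_all add: binomial_eq_0)
    then show "{k. smult (of_nat (n choose k)) (poly_binomial [:of_nat n - of_nat k, 1 :: rat:] (n + 1)) \<noteq> 0}
        \<subseteq> {..n}" by blast
  qed simp
  finally show ?thesis .
qed

end
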